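(* Let $(Y,\mathrm{d}_Y,g)$ satisfy Wieler's axioms with associated Wieler solenoid $(X,\varphi)$, let $\mathbf{P}$ be a finite $\varphi$-invariant set of periodic points of $\varphi$, and let $\tilde{g}$ on $X^u(\mathbf{P})/{\sim_0}$, $r:X^u(\mathbf{P})/{\sim_0}\to Y$, $s:Y\to X^u(\mathbf{P})/{\sim_0}$, the constant $K_0$, and $(\tilde{X},\tilde{\varphi})$ be as in the context. Then $r$ and $s$ define a shift equivalence, that is, $$r\circ\tilde{g}=g\circ r,\quad s\circ g=\tilde{g}\circ s,\quad r\circ s=g^{K_0},\quad s\circ r=\tilde{g}^{K_0}.$$ Moreover, the map $S:X\to\tilde{X}$, $(y_0,y_1,y_2,\dots)\mapsto(s(y_0),s(y_1),s(y_2),\dots)$, is a conjugacy from $(X,\varphi)$ to $(\tilde{X},\tilde{\varphi})$ (a homeomorphism with $S\circ\varphi=\tilde\varphi\circ S$).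
   Context: $\mathbb{N}=\{0,1,2,\dots\}$. Wieler's axioms: $(Y,\mathrm{d}_Y)$ is an infinite compact metric space, $g:Y\to Y$ is a continuous surjection, and there are $\beta>0$, $K\in\mathbb{N}^+$, $0<\gamma<1$ with (Axiom 1) if $\mathrm{d}_Y(x,y)\le\beta$ then $\mathrm{d}_Y(g^K(x),g^K(y))\le\gamma^K\mathrm{d}_Y(g^{2K}(x),g^{2K}(y))$; (Axiom 2) $g^K(B(g^K(x),\epsilon))\subseteq g^{2K}(B(x,\gamma\epsilon))$ for all $x\in Y$, $0<\epsilon\le\beta$. The Wieler solenoid is $X=\{\mathbf{x}=(x_n)_{n\in\mathbb{N}}: x_n\in Y,\ g(x_{n+1})=x_n\}$ with homeomorphism $\varphi(x_0,x_1,\dots)=(g(x_0),x_0,x_1,\dots)$ and metric $\mathrm{d}_X(\mathbf{x},\mathbf{y})=\sum_{i=0}^K\gamma^i\mathrm{d}'_X(\varphi^i(\mathbf{x}),\varphi^i(\mathbf{y}))$, $\mathrm{d}'_X(\mathbf{x},\mathbf{y})=\sup_n\gamma^n\mathrm{d}_Y(x_n,y_n)$ (inducing the product topology). Write $\mathbf{x}\sim_u\mathbf{y}$ if $\mathrm{d}_X(\varphi^{-n}(\mathbf{x}),\varphi^{-n}(\mathbf{y}))\to0$ as $n\to\infty$. Put $X^u(\mathbf{P})=\{\mathbf{x}\in X:\mathbf{x}\sim_u\mathbf{p}\text{ for some }\mathbf{p}\in\mathbf{P}\}$ and, for $0<\epsilon\le\beta/2$, $X^u(\mathbf{x},\epsilon)=\{\mathbf{y}\in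 X:\mathrm{d}_Y(x_n,y_n)<\epsilon\ \forall n,\ \mathrm{d}_X(\mathbf{x},\mathbf{y})<\epsilon\}$. $X^u(\mathbf{P})$ carries the locally compact Hausdorff topology for which the sets $X^u(\mathbf{x},\epsilon)$ form a neighbourhood base at $\mathbf{x}$. Let $\pi_0:X^u(\mathbf{P})\to Y$, $\pi_0(\mathbf{x})=x_0$. Fix a sufficiently small constant $0<\epsilon_Y\le\beta/2$ (so that $\pi_0$ is injective on each $X^u(\mathbf{z},\epsilon_Y)$). For $\mathbf{x},\mathbf{y}\in X^u(\mathbf{P})$, $\mathbf{x}\sim_0\mathbf{y}$ means: $x_0=y_0$ and there are $0<\delta<\epsilon_Y$ and an open $U\subseteq X^u(\mathbf{y},\epsilon_Y)$ with $\pi_0(X^u(\mathbf{x},\delta))=\pi_0(U)$. This is an equivalence relation; $X^u(\mathbf{P})/{\sim_0}$ has the quotient topology (possibly non-Hausdorff). The maps $\tilde{g}([\mathbf{x}]_0)=[\varphi(\mathbf{x})]_0$ and $r([\mathbf{x}]_0)=x_0$ are well defined, and it is taken as known that $r$ is a continuous surjection. Known fact: there is a constant $K_0>0$ such that if $\mathbf{x},\mathbf{y}\in X^u(\mathbf{P})$ satisfy $x_i=y_i$ for $0\le i\le K_0$, then $\mathbf{x}\sim_0\mathbf{y}$; fix such a $K_0$. The map $s$ is $s(y)=[(g^{K_0}(y),g^{K_0-1}(y),\dots,g(y),y,x_1,x_2,\dots)]_0$, where $(y,x_1,x_2,\dots)$ is any element of $X^u(\mathbf{P})$ with zeroth coordinate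 $y$; by the known fact the result does not depend on the choice. Finally $\tilde{X}=\varprojlim(X^u(\mathbf{P})/{\sim_0},\tilde{g})=\{(\tilde{y}_n)_{n\in\mathbb{N}}:\tilde{g}(\tilde{y}_{n+1})=\tilde{y}_n\}$ with the subspace topology of the product and $\tilde{\varphi}(\tilde{y}_0,\tilde{y}_1,\dots)=(\tilde{g}(\tilde{y}_0),\tilde{y}_0,\tilde{y}_1,\dots)$. *)

theory Defs
  imports "HOL-Analysis.Analysis"
begin

text \<open>With \<open>A\<close> the whole type this is the Wieler solenoid, with shift \<open>\<phi>\<close>; with \<open>A\<close> the
  quotient of \<open>X\<^sup>u(P)\<close> it is the solenoid over the quotient.\<close>

definition inverse_limit :: "'b set \<Rightarrow> ('b \<Rightarrow> 'b) \<Rightarrow> (nat \<Rightarrow> 'b) set" where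
  "inverse_limit A f = {x. (\<forall>n. x n \<in> A) \<and> (\<forall>n. f (x (Suc n)) = x n)}"

definition limit_shift :: "('b \<Rightarrow> 'b) \<Rightarrow> (nat \<Rightarrow> 'b) \<Rightarrow> nat \<Rightarrow> 'b" where
  "limit_shift f x = (\<lambda>n. case n of 0 \<Rightarrow> f (x 0) | Suc m \<Rightarrow> x m)"

definition conjugacy ::
  "'a topology \<Rightarrow> ('a \<Rightarrow> 'a) \<Rightarrow> 'b topology \<Rightarrow> ('b \<Rightarrow> 'b) \<Rightarrow> ('a \<Rightarrow> 'b) \<Rightarrow> bool" where
  "conjugacy T f T' f' h \<longleftrightarrow>
     homeomorphic_map T T' h \<and> (\<forall>x\<in>topspace T. h (f x) = f' (h x))"

text \<open>The space \<open>Y\<close> is the whole type \<open>'a\<close>, with metric \<^const>\<open>dist\<close>.\<close>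

definition wieler_axioms :: "('a::metric_space \<Rightarrow> 'a) \<Rightarrow> real \<Rightarrow> nat \<Rightarrow> real \<Rightarrow> bool" where
  "wieler_axioms g \<beta> K \<gamma> \<longleftrightarrow>
     compact (UNIV :: 'a set) \<and> infinite (UNIV :: 'a set) \<and>
     continuous_on UNIV g \<and> surj g \<and> 0 < \<beta> \<and> 0 < K \<and> 0 < \<gamma> \<and> \<gamma> < 1 \<and>
     (\<forall>x y. dist x y \<le> \<beta> \<longrightarrow>
        dist ((g ^^ K) x) ((g ^^ K) y) \<le> \<gamma> ^ K * dist ((g ^^ (2 * K)) x) ((g ^^ (2 * K)) y)) \<and>
     (\<forall>x \<epsilon>. 0 < \<epsilon> \<and> \<epsilon> \<le> \<beta> \<longrightarrow>
        (g ^^ K) ` ball ((g ^^ K) x) \<epsilon> \<subseteq> (g ^^ (2 * K)) ` ball x (\<gamma> * \<epsilon>))"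

abbreviation solenoid :: "('a \<Rightarrow> 'a) \<Rightarrow> (nat \<Rightarrow> 'a) set" where
  "solenoid g \<equiv> inverse_limit UNIV g"

definition sol_dist' :: "real \<Rightarrow> (nat \<Rightarrow> 'a::metric_space) \<Rightarrow> (nat \<Rightarrow> 'a) \<Rightarrow> real" where
  "sol_dist' \<gamma> x y = (SUP n. \<gamma> ^ n * dist (x n) (y n))"

definition sol_dist ::
  "('a::metric_space \<Rightarrow> 'a) \<Rightarrow> nat \<Rightarrow> real \<Rightarrow> (nat \<Rightarrow> 'a) \<Rightarrow> (nat \<Rightarrow> 'a) \<Rightarrow> real" where
  "sol_dist g K \<gamma> x y =
     (\<Sum>i=0..K. \<gamma> ^ i * sol_dist' \<gamma> ((limit_shift g ^^ i) x) ((limit_shift g ^^ i) y))"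

definition sol_topology ::
  "('a::metric_space \<Rightarrow> 'a) \<Rightarrow> nat \<Rightarrow> real \<Rightarrow> (nat \<Rightarrow> 'a) topology" where
  "sol_topology g K \<gamma> = Metric_space.mtopology (solenoid g) (sol_dist g K \<gamma>)"

definition unstable_equiv ::
  "('a::metric_space \<Rightarrow> 'a) \<Rightarrow> nat \<Rightarrow> real \<Rightarrow> (nat \<Rightarrow> 'a) \<Rightarrow> (nat \<Rightarrow> 'a) \<Rightarrow> bool" where
  "unstable_equiv g K \<gamma> x y \<longleftrightarrow>
     (let \<psi> = inv_into (solenoid g) (limit_shift g)
      in (\<lambda>n. sol_dist g K \<gamma> ((\<psi> ^^ n) x) ((\<psi> ^^ n) y)) \<longlonglongrightarrow> 0)"

definition Xu ::
  "('a::metric_space \<Rightarrow> 'a) \<Rightarrow> nat \<Rightarrow> real \<Rightarrow> (nat \<Rightarrow> 'a) set \<Rightarrow> (nat \<Rightarrow> 'a) set" where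
  "Xu g K \<gamma> P = {x \<in> solenoid g. \<exists>p\<in>P. unstable_equiv g K \<gamma> x p}"

definition Xu_nbhd ::
  "('a::metric_space \<Rightarrow> 'a) \<Rightarrow> nat \<Rightarrow> real \<Rightarrow> (nat \<Rightarrow> 'a) \<Rightarrow> real \<Rightarrow> (nat \<Rightarrow> 'a) set" where
  "Xu_nbhd g K \<gamma> x \<epsilon> =
     {y \<in> solenoid g. (\<forall>n. dist (x n) (y n) < \<epsilon>) \<and> sol_dist g K \<gamma> x y < \<epsilon>}"

definition Xu_topology ::
  "('a::metric_space \<Rightarrow> 'a) \<Rightarrow> real \<Rightarrow> nat \<Rightarrow> real \<Rightarrow> (nat \<Rightarrow> 'a) set \<Rightarrow> (nat \<Rightarrow> 'a) topology" where
  "Xu_topology g \<beta> K \<gamma> P = topology (\<lambda>U. U \<subseteq> Xu g K \<gamma> P \<and>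
     (\<forall>x\<in>U. \<exists>\<epsilon>. 0 < \<epsilon> \<and> \<epsilon> \<le> \<beta> / 2 \<and> Xu_nbhd g K \<gamma> x \<epsilon> \<subseteq> U))"

lemma openin_Xu_topology:
  "openin (Xu_topology g \<beta> K \<gamma> P) U \<longleftrightarrow> U \<subseteq> Xu g K \<gamma> P \<and>
     (\<forall>x\<in>U. \<exists>\<epsilon>. 0 < \<epsilon> \<and> \<epsilon> \<le> \<beta> / 2 \<and> Xu_nbhd g K \<gamma> x \<epsilon> \<subseteq> U)"
proof -
  let ?N = "Xu_nbhd g K \<gamma>"
  have mono: "?N x a \<subseteq> ?N x b" if "a \<le> b" for x a b
    using that by (auto simp: Xu_nbhd_def intro: less_le_trans)
  have "istopology (\<lambda>U. U \<subseteq> Xu g K \<gamma> P \<and>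
     (\<forall>x\<in>U. \<exists>\<epsilon>. 0 < \<epsilon> \<and> \<epsilon> \<le> \<beta> / 2 \<and> ?N x \<epsilon> \<subseteq> U))" (is "istopology ?L")
    unfolding istopology_def
  proof (intro conjI allI impI)
    fix S T assume S: "?L S" and T: "?L T"
    show "S \<inter> T \<subseteq> Xu g K \<gamma> P" using S by blast
    show "\<forall>x\<in>S \<inter> T. \<exists>\<epsilon>. 0 < \<epsilon> \<and> \<epsilon> \<le> \<beta> / 2 \<and> ?N x \<epsilon> \<subseteq> S \<inter> T"
    proof
      fix x assume "x \<in> S \<inter> T"
      then obtain a b where "0 < a" "a \<le> \<beta> / 2" "?N x a \<subseteq> S" "0 < b" "?N x b \<subseteq> T"
        using S T by blast
      then have "0 < min a b \<and> min a b \<le> \<beta> / 2 \<and> ?N x (min a b) \<subseteq> S \<inter> T"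
        using mono[of "min a b" a x] mono[of "min a b" b x] by auto
      then show "\<exists>\<epsilon>. 0 < \<epsilon> \<and> \<epsilon> \<le> \<beta> / 2 \<and> ?N x \<epsilon> \<subseteq> S \<inter> T" by blast
    qed
  next
    fix \<K> assume \<K>: "\<forall>U\<in>\<K>. ?L U"
    show "\<Union>\<K> \<subseteq> Xu g K \<gamma> P" using \<K> by blast
    show "\<forall>x\<in>\<Union>\<K>. \<exists>\<epsilon>. 0 < \<epsilon> \<and> \<epsilon> \<le> \<beta> / 2 \<and> ?N x \<epsilon> \<subseteq> \<Union>\<K>"
      using \<K> by (meson Union_iff Union_upper order_trans)
  qed
  then show ?thesis by (simp add: Xu_topology_def)
qed

definition rel0 ::
  "('a::metric_space \<Rightarrow> 'a) \<Rightarrow> real \<Rightarrow> nat \<Rightarrow> real \<Rightarrow> (nat \<Rightarrow> 'a) set \<Rightarrow> real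
     \<Rightarrow> ((nat \<Rightarrow> 'a) \<times> (nat \<Rightarrow> 'a)) set" where
  "rel0 g \<beta> K \<gamma> P \<epsilon>Y =
     {(x, y). x \<in> Xu g K \<gamma> P \<and> y \<in> Xu g K \<gamma> P \<and> x 0 = y 0 \<and>
        (\<exists>\<delta> U. 0 < \<delta> \<and> \<delta> < \<epsilon>Y \<and> openin (Xu_topology g \<beta> K \<gamma> P) U \<and>
           U \<subseteq> Xu_nbhd g K \<gamma> y \<epsilon>Y \<and>
           (\<lambda>z. z 0) ` Xu_nbhd g K \<gamma> x \<delta> = (\<lambda>z. z 0) ` U)}"

definition quotient_topology :: "'b topology \<Rightarrow> ('b \<times> 'b) set \<Rightarrow> 'b set topology" where
  "quotient_topology T R = topology (\<lambda>V. V \<subseteq> topspace T // R \<and>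
     openin T {x \<in> topspace T. R `` {x} \<in> V})"

lemma openin_quotient_topology:
  "openin (quotient_topology T R) V \<longleftrightarrow>
     V \<subseteq> topspace T // R \<and> openin T {x \<in> topspace T. R `` {x} \<in> V}"
proof -
  have "istopology (\<lambda>V. V \<subseteq> topspace T // R \<and> openin T {x \<in> topspace T. R `` {x} \<in> V})"
    (is "istopology ?L")
    unfolding istopology_def
  proof (intro conjI allI impI)
    fix S S' assume S: "?L S" and S': "?L S'"
    show "S \<inter> S' \<subseteq> topspace T // R" using S by blast
    have "{x \<in> topspace T. R `` {x} \<in> S \<inter> S'} =
        {x \<in> topspace T. R `` {x} \<in> S} \<inter> {x \<in> topspace T. R `` {x} \<in> S'}" by blast
    then show "openin T {x \<in> topspace T. R `` {x} \<in> S \<inter> S'}"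
      using S S' by (simp add: openin_Int)
  next
    fix \<K> assume \<K>: "\<forall>V\<in>\<K>. ?L V"
    show "\<Union>\<K> \<subseteq> topspace T // R" using \<K> by blast
    have "{x \<in> topspace T. R `` {x} \<in> \<Union>\<K>} = (\<Union>V\<in>\<K>. {x \<in> topspace T. R `` {x} \<in> V})" by blast
    then show "openin T {x \<in> topspace T. R `` {x} \<in> \<Union>\<K>}"
      using \<K> by auto
  qed
  then show ?thesis by (simp add: quotient_topology_def)
qed

definition Xu_quot ::
  "('a::metric_space \<Rightarrow> 'a) \<Rightarrow> real \<Rightarrow> nat \<Rightarrow> real \<Rightarrow> (nat \<Rightarrow> 'a) set \<Rightarrow> real
     \<Rightarrow> (nat \<Rightarrow> 'a) set set" where
  "Xu_quot g \<beta> K \<gamma> P \<epsilon>Y = Xu g K \<gamma> P // rel0 g \<beta> K \<gamma> P \<epsilon>Y"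

text \<open>In the next three definitions, \<^const>\<open>the_elem\<close> picks the common value obtained from
  all choices of representative (or of preimage); it is meaningful because that value is
  independent of the choice.\<close>

definition gtilde ::
  "('a::metric_space \<Rightarrow> 'a) \<Rightarrow> real \<Rightarrow> nat \<Rightarrow> real \<Rightarrow> (nat \<Rightarrow> 'a) set \<Rightarrow> real
     \<Rightarrow> (nat \<Rightarrow> 'a) set \<Rightarrow> (nat \<Rightarrow> 'a) set" where
  "gtilde g \<beta> K \<gamma> P \<epsilon>Y c =
     the_elem ((\<lambda>x. rel0 g \<beta> K \<gamma> P \<epsilon>Y `` {limit_shift g x}) ` c)"

definition rmap :: "(nat \<Rightarrow> 'a) set \<Rightarrow> 'a" where
  "rmap c = the_elem ((\<lambda>x. x 0) ` c)"

definition smap ::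
  "('a::metric_space \<Rightarrow> 'a) \<Rightarrow> real \<Rightarrow> nat \<Rightarrow> real \<Rightarrow> (nat \<Rightarrow> 'a) set \<Rightarrow> real \<Rightarrow> nat
     \<Rightarrow> 'a \<Rightarrow> (nat \<Rightarrow> 'a) set" where
  "smap g \<beta> K \<gamma> P \<epsilon>Y K0 y =
     the_elem ((\<lambda>x. rel0 g \<beta> K \<gamma> P \<epsilon>Y ``
          {\<lambda>n. if n \<le> K0 then (g ^^ (K0 - n)) y else x (n - K0)})
        ` {x \<in> Xu g K \<gamma> P. x 0 = y})"

definition Xtilde ::
  "('a::metric_space \<Rightarrow> 'a) \<Rightarrow> real \<Rightarrow> nat \<Rightarrow> real \<Rightarrow> (nat \<Rightarrow> 'a) set \<Rightarrow> real
     \<Rightarrow> (nat \<Rightarrow> (nat \<Rightarrow> 'a) set) set" where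
  "Xtilde g \<beta> K \<gamma> P \<epsilon>Y = inverse_limit (Xu_quot g \<beta> K \<gamma> P \<epsilon>Y) (gtilde g \<beta> K \<gamma> P \<epsilon>Y)"

definition Xtilde_topology ::
  "('a::metric_space \<Rightarrow> 'a) \<Rightarrow> real \<Rightarrow> nat \<Rightarrow> real \<Rightarrow> (nat \<Rightarrow> 'a) set \<Rightarrow> real
     \<Rightarrow> (nat \<Rightarrow> (nat \<Rightarrow> 'a) set) topology" where
  "Xtilde_topology g \<beta> K \<gamma> P \<epsilon>Y =
     subtopology
       (product_topology
          (\<lambda>n. quotient_topology (Xu_topology g \<beta> K \<gamma> P) (rel0 g \<beta> K \<gamma> P \<epsilon>Y)) UNIV)
       (Xtilde g \<beta> K \<gamma> P \<epsilon>Y)"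

end

theory Submission
  imports Defs
begin

text \<open>Call two points of \<open>X\<^sup>u(P)\<close> germ-equivalent if small unstable neighbourhoods of them have
  the same images in \<open>Y\<close> near the common zeroth coordinate. By the first axiom the zeroth
  coordinate determines nearby points of a leaf uniformly continuously, so this is exactly
  \<open>\<sim>\<^sub>0\<close>; hence \<open>\<sim>\<^sub>0\<close> is a \<open>\<phi>\<close>-invariant equivalence relation. As \<open>s\<close> sends
  \<open>x\<^sub>0\<close> to the class of \<open>\<phi> ^^ K0\<close> applied to \<open>x\<close>, the shift equivalence is immediate, and
  \<open>S\<close> is inverted by \<open>c \<mapsto> (r (c (n + K0)))\<^sub>n\<close>, which is continuous because \<open>r\<close> is. For the
  continuity of \<open>S\<close>, the second axiom shows that \<open>s \<circ> g ^^ K\<close> is continuous, and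
  \<open>s (y\<^sub>n) = s (g ^^ K (y\<^bsub>n+K\<^esub>))\<close>.\<close>

section \<open>Inverse limits of an arbitrary map and their shift\<close>

lemma limit_shift_0 [simp]: "limit_shift f x 0 = f (x 0)"
  and limit_shift_Suc [simp]: "limit_shift f x (Suc n) = x n"
  by (simp_all add: limit_shift_def)

text \<open>At \<open>n = i\<close> both branches would give \<open>x 0\<close>; splitting at
  \<open>n \<le> i\<close> matches the representatives inside \<open>smap\<close>.\<close>

lemma funpow_limit_shift:
  "(limit_shift f ^^ i) x n = (if n \<le> i then (f ^^ (i - n)) (x 0) else x (n - i))"
proof (induction i arbitrary: n)
  case 0
  then show ?case by simp
next
  case (Suc i)
  then show ?case
    by (cases n) (auto simp: Suc_diff_le)
qed

lemma inverse_limit_funpow: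
  assumes "x \<in> inverse_limit A f"
  shows "(f ^^ k) (x (n + k)) = x n"
  using assms by (induction k) (auto simp: inverse_limit_def funpow_swap1)

lemma limit_shift_in_inverse_limit:
  assumes "x \<in> inverse_limit A f" "f \<in> A \<rightarrow> A"
  shows "limit_shift f x \<in> inverse_limit A f"
  using assms by (auto simp: inverse_limit_def limit_shift_def split: nat.splits)

lemma shift_in_inverse_limit:
  "x \<in> inverse_limit A f \<Longrightarrow> (\<lambda>n. x (n + k)) \<in> inverse_limit A f"
  by (auto simp: inverse_limit_def)

lemma limit_shift_shift:
  "x \<in> inverse_limit A f \<Longrightarrow> limit_shift f (\<lambda>n. x (Suc n)) = x"
  by (rule ext) (simp add: limit_shift_def inverse_limit_def split: nat.splits)

text \<open>\<open>limit_shift f x\<close> keeps all of \<open>x\<close> in its positive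
  coordinates, so the shift is injective and its inverse drops the zeroth coordinate. This turns the
  \<open>inv_into\<close> of \<open>unstable_equiv\<close> into a statement about tails.\<close>

lemma inv_into_limit_shift:
  assumes "x \<in> inverse_limit A f" 
  shows "inv_into (inverse_limit A f) (limit_shift f) x = (\<lambda>n. x (Suc n))"
proof (rule inv_into_f_eq)
  show "inj_on (limit_shift f) (inverse_limit A f)"
  proof (rule inj_onI)
    fix x y assume eq: "limit_shift f x = limit_shift f y"
    show "x = y"
      by (rule ext) (metis eq limit_shift_Suc)
  qed
  show "(\<lambda>n. x (Suc n)) \<in> inverse_limit A f"
    using shift_in_inverse_limit[OF assms, of 1] by simp
  show "limit_shift f (\<lambda>n. x (Suc n)) = x"
    by (rule limit_shift_shift[OF assms])
qed

lemma funpow_inv_into_limit_shift: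
  assumes "x \<in> inverse_limit A f"
  shows "(inv_into (inverse_limit A f) (limit_shift f) ^^ n) x = (\<lambda>m. x (m + n))"
proof (induction n)
  case (Suc n)
  then show ?case
    using inv_into_limit_shift[OF shift_in_inverse_limit[OF assms, of n]] by simp
qed simp

lemma topspace_quotient_topology: "topspace (quotient_topology T R) = topspace T // R"
proof -
  have "{x \<in> topspace T. R `` {x} \<in> topspace T // R} = topspace T"
    by (auto intro: quotientI)
  then have "openin (quotient_topology T R) (topspace T // R)"
    by (simp add: openin_quotient_topology)
  then have "topspace T // R \<subseteq> topspace (quotient_topology T R)" by (rule openin_subset)
  moreover have "topspace (quotient_topology T R) \<subseteq> topspace T // R"
    using openin_topspace openin_quotient_topology by blast
  ultimately show ?thesis by blast
qed

section \<open>Compactness and the metric of the solenoid\<close>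

locale wieler =
  fixes g :: "'a::metric_space \<Rightarrow> 'a" and \<beta> :: real and K :: nat and \<gamma> :: real
  assumes wieler: "wieler_axioms g \<beta> K \<gamma>"
begin

abbreviation X where "X \<equiv> solenoid g"
abbreviation \<phi> where "\<phi> \<equiv> limit_shift g"
abbreviation dX where "dX \<equiv> sol_dist g K \<gamma>"
abbreviation N where "N \<equiv> Xu_nbhd g K \<gamma>"

lemma compact_Y: "compact (UNIV :: 'a set)"
  and cont_g: "continuous_on UNIV g"
  and \<beta>_pos: "0 < \<beta>" and K_pos: "0 < K" and \<gamma>_pos: "0 < \<gamma>" and \<gamma>_less: "\<gamma> < 1"
  and axiom1: "dist x y \<le> \<beta> \<Longrightarrow>
     dist ((g ^^ K) x) ((g ^^ K) y) \<le> \<gamma> ^ K * dist ((g ^^ (2 * K)) x) ((g ^^ (2 * K)) y)"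
  and axiom2: "0 < \<epsilon> \<Longrightarrow> \<epsilon> \<le> \<beta> \<Longrightarrow>
     (g ^^ K) ` ball ((g ^^ K) x) \<epsilon> \<subseteq> (g ^^ (2 * K)) ` ball x (\<gamma> * \<epsilon>)"
  using wieler unfolding wieler_axioms_def by auto

lemma power_\<gamma>_le: "\<gamma> ^ n \<le> 1"
  using \<gamma>_pos \<gamma>_less by (simp add: power_le_one)

lemma dist_bounded: obtains D where "0 < D" "\<And>x y::'a. dist x y \<le> D"
proof -
  obtain e where e: "\<And>x y::'a. dist x y \<le> e"
    using compact_imp_bounded[OF compact_Y] unfolding bounded_two_points by auto
  have "dist x y \<le> max e 1" for x y :: 'a
    using e[of x y] by simp
  then show thesis using that[of "max e 1"] by simp
qed

text \<open>Compactness makes \<open>g\<close> uniformly continuous; by induction one radius serves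
  all the finitely many iterates up to \<open>m\<close>.\<close>

lemma uniform_funpow:
  assumes "0 < \<eta>"
  obtains \<rho> where "0 < \<rho>"
    "\<And>j x y. j \<le> m \<Longrightarrow> dist x y < \<rho> \<Longrightarrow> dist ((g ^^ j) x) ((g ^^ j) y) < \<eta>"
proof -
  have "\<exists>\<rho>>0. \<forall>j\<le>m. \<forall>x y. dist x y < \<rho> \<longrightarrow> dist ((g ^^ j) x) ((g ^^ j) y) < \<eta>"
  proof (induction m)
    case 0
    then show ?case using assms by auto
  next
    case (Suc m)
    then obtain \<rho> where \<rho>: "0 < \<rho>"
      "\<And>j x y. j \<le> m \<Longrightarrow> dist x y < \<rho> \<Longrightarrow> dist ((g ^^ j) x) ((g ^^ j) y) < \<eta>"
      by blast
    have "uniformly_continuous_on UNIV g"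
      using compact_uniformly_continuous[OF cont_g compact_Y] .
    then obtain \<sigma> where \<sigma>: "0 < \<sigma>" "\<And>x y. dist x y < \<sigma> \<Longrightarrow> dist (g x) (g y) < \<rho>"
      using \<open>0 < \<rho>\<close> unfolding uniformly_continuous_on_def by (metis UNIV_I dist_commute)
    have "dist ((g ^^ j) x) ((g ^^ j) y) < \<eta>"
      if "j \<le> Suc m" "dist x y < min \<rho> \<sigma>" for j x y
    proof (cases "j \<le> m")
      case True
      then show ?thesis using \<rho> that by simp
    next
      case False
      then have "j = Suc m" using that by simp
      then show ?thesis
        using \<rho>(2)[of m "g x" "g y"] \<sigma>(2)[of x y] that by (simp add: funpow_swap1)
    qed
    then show ?case using \<rho>(1) \<sigma>(1) by (intro exI[of _ "min \<rho> \<sigma>"]) auto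
  qed
  then show thesis using that by blast
qed

lemma \<phi>_in: "x \<in> X \<Longrightarrow> \<phi> x \<in> X"
  by (rule limit_shift_in_inverse_limit) auto

lemma funpow_\<phi>_in: "x \<in> X \<Longrightarrow> (\<phi> ^^ i) x \<in> X"
  by (induction i) (auto intro: \<phi>_in)

text \<open>A real \<open>SUP\<close> is informative only for bounded sets. Distances are bounded by
  compactness and the weights are at most 1.\<close>

lemma bdd_above_sol_dist': "bdd_above (range (\<lambda>n. \<gamma> ^ n * dist (x n) (y n :: 'a)))"
proof -
  obtain D where D: "0 < D" "\<And>x y::'a. dist x y \<le> D" using dist_bounded by metis
  have "\<gamma> ^ n * dist (x n) (y n) \<le> D" for n
    using mult_mono[OF power_\<gamma>_le D(2)] by simp
  then show ?thesis by (intro bdd_aboveI[of _ D]) auto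
qed

lemma le_sol_dist': "\<gamma> ^ n * dist (x n) (y n :: 'a) \<le> sol_dist' \<gamma> x y"
  unfolding sol_dist'_def by (rule cSUP_upper[OF _ bdd_above_sol_dist']) simp

lemma sol_dist'_nonneg: "0 \<le> sol_dist' \<gamma> x (y :: nat \<Rightarrow> 'a)"
  using le_sol_dist'[of 0 x y] by (auto intro: order_trans[OF zero_le_dist])

lemma sol_dist'_le: "(\<And>n. \<gamma> ^ n * dist (x n) (y n :: 'a) \<le> c) \<Longrightarrow> sol_dist' \<gamma> x y \<le> c"
  unfolding sol_dist'_def by (rule cSUP_least) auto

lemma sol_dist'_commute: "sol_dist' \<gamma> x y = sol_dist' \<gamma> y (x :: nat \<Rightarrow> 'a)"
  unfolding sol_dist'_def by (simp add: dist_commute)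

lemma sol_dist'_triangle: "sol_dist' \<gamma> x z \<le> sol_dist' \<gamma> x y + sol_dist' \<gamma> y (z :: nat \<Rightarrow> 'a)"
proof (rule sol_dist'_le)
  fix n
  have "\<gamma> ^ n * dist (x n) (z n) \<le> \<gamma> ^ n * dist (x n) (y n) + \<gamma> ^ n * dist (y n) (z n)"
    using \<gamma>_pos by (simp flip: distrib_left add: dist_triangle)
  then show "\<gamma> ^ n * dist (x n) (z n) \<le> sol_dist' \<gamma> x y + sol_dist' \<gamma> y z"
    using le_sol_dist'[of n x y] le_sol_dist'[of n y z] by linarith
qed

text \<open>The summand \<open>i = 0\<close> of \<open>dX\<close> is \<open>sol_dist'\<close>
  itself, and the other summands are nonnegative.\<close>

lemma dist_le_dX: "\<gamma> ^ n * dist (x n) (y n) \<le> dX x y"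
proof -
  have "sol_dist' \<gamma> x y \<le> dX x y"
    unfolding sol_dist_def
    using member_le_sum[of 0 "{0..K}"
        "\<lambda>i. \<gamma> ^ i * sol_dist' \<gamma> ((\<phi> ^^ i) x) ((\<phi> ^^ i) y)"] \<gamma>_pos sol_dist'_nonneg
    by simp
  then show ?thesis using le_sol_dist'[of n x y] by linarith
qed

lemma dX_commute: "dX x y = dX y x"
  unfolding sol_dist_def by (simp add: sol_dist'_commute)

lemma dX_triangle: "dX x z \<le> dX x y + dX y z"
  unfolding sol_dist_def sum.distrib[symmetric] distrib_left[symmetric]
  using \<gamma>_pos by (intro sum_mono mult_left_mono sol_dist'_triangle) auto

lemma dX_nonneg: "0 \<le> dX x y"
  unfolding sol_dist_def using \<gamma>_pos sol_dist'_nonneg by (intro sum_nonneg) auto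

lemma dX_eq_0: "dX x y = 0 \<longleftrightarrow> x = y"
proof
  assume 0: "dX x y = 0"
  show "x = y"
  proof
    fix n
    have "\<gamma> ^ n * dist (x n) (y n) \<le> 0" using dist_le_dX[of n x y] 0 by simp
    then show "x n = y n" using zero_less_power[OF \<gamma>_pos, of n] by (simp add: mult_le_0_iff)
  qed
next
  assume "x = y"
  then show "dX x y = 0" by (simp add: sol_dist_def sol_dist'_def)
qed

sublocale Xm: Metric_space X dX
  by unfold_locales (auto simp: dX_nonneg dX_commute dX_triangle dX_eq_0)

text \<open>Early coordinates are images of the \<open>m\<close>-th one, late ones are damped by \<open>\<gamma> ^ m\<close>.\<close>

lemma dX_small:
  assumes "0 < \<epsilon>"
  obtains m \<rho> where "0 < \<rho>" "\<And>x y. x \<in> X \<Longrightarrow> y \<in> X \<Longrightarrow> dist (x m) (y m) < \<rho> \<Longrightarrow> dX x y < \<epsilon>"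
proof -
  obtain D where D: "0 < D" "\<And>x y::'a. dist x y \<le> D" using dist_bounded by metis
  \<comment> \<open>\<open>dX\<close> has \<open>K + 1\<close> summands; a bound \<open>c\<close> on
    each keeps the sum at most half of \<open>\<epsilon>\<close>.\<close>
  define c where "c = \<epsilon> / (2 * (K + 1))"
  have c: "0 < c" "(K + 1) * c < \<epsilon>" using assms by (simp_all add: c_def field_simps add_pos_nonneg)
  obtain m where m: "\<gamma> ^ m < c / D"
    using real_arch_pow_inv[of "c / D" \<gamma>] c D(1) \<gamma>_less by auto
  \<comment> \<open>\<open>m + K\<close> bounds every exponent \<open>m + i - n\<close> that occurs
    when coordinate \<open>n\<close> of \<open>(\<phi> ^^ i) x\<close> is written as an image of
    \<open>x m\<close>.\<close>
  obtain \<rho> where \<rho>: "0 < \<rho>"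
    "\<And>j x y. j \<le> m + K \<Longrightarrow> dist x y < \<rho> \<Longrightarrow> dist ((g ^^ j) x) ((g ^^ j) y) < c"
    using uniform_funpow[OF c(1)] by metis
  have "dX x y < \<epsilon>" if x: "x \<in> X" and y: "y \<in> X" and xy: "dist (x m) (y m) < \<rho>" for x y
  proof -
    have bound: "\<gamma> ^ n * dist ((\<phi> ^^ i) x n) ((\<phi> ^^ i) y n) \<le> c" if i: "i \<le> K" for i n
    proof (cases "n \<le> m + i")
      case True
      have coord: "(\<phi> ^^ i) z n = (g ^^ (m + i - n)) (z m)" if "z \<in> X" for z
      proof -
        have "(g ^^ (m + i - n)) ((\<phi> ^^ i) z (n + (m + i - n))) = (\<phi> ^^ i) z n"
          by (rule inverse_limit_funpow[OF funpow_\<phi>_in[OF that]])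
        moreover have "(\<phi> ^^ i) z (m + i) = z m"
          by (cases m) (auto simp: funpow_limit_shift)
        ultimately show ?thesis using True by simp
      qed
      have "dist ((\<phi> ^^ i) x n) ((\<phi> ^^ i) y n) \<le> c"
        using \<rho>(2)[of "m + i - n", OF _ xy] i coord x y by (simp add: less_imp_le)
      then show ?thesis
        using mult_mono[OF power_\<gamma>_le, of "dist ((\<phi> ^^ i) x n) ((\<phi> ^^ i) y n)" c n] by simp
    next
      case False
      then have "\<gamma> ^ n \<le> \<gamma> ^ m" using \<gamma>_pos \<gamma>_less by (intro power_decreasing) auto
      then have "\<gamma> ^ n * dist ((\<phi> ^^ i) x n) ((\<phi> ^^ i) y n) \<le> \<gamma> ^ m * D"
        using D \<gamma>_pos by (intro mult_mono) auto
      also have "\<dots> \<le> c" using m D(1) by (simp add: field_simps)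
      finally show ?thesis .
    qed
    have "dX x y \<le> (\<Sum>i=0..K. c)"
      unfolding sol_dist_def
    proof (rule sum_mono)
      fix i assume "i \<in> {0..K}"
      then have "sol_dist' \<gamma> ((\<phi> ^^ i) x) ((\<phi> ^^ i) y) \<le> c"
        by (intro sol_dist'_le bound) auto
      then show "\<gamma> ^ i * sol_dist' \<gamma> ((\<phi> ^^ i) x) ((\<phi> ^^ i) y) \<le> c"
        using mult_mono[OF power_\<gamma>_le, of "sol_dist' \<gamma> ((\<phi> ^^ i) x) ((\<phi> ^^ i) y)" c i]
          sol_dist'_nonneg c by simp
    qed
    also have "\<dots> < \<epsilon>" using c(2) by (simp add: algebra_simps)
    finally show ?thesis .
  qed
  then show thesis using that[of \<rho> m] \<rho>(1) by blast
qed

section \<open>Unstable neighbourhoods and contraction along leaves\<close>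

lemma uniform_imp_N:
  assumes "0 < \<eta>"
  obtains \<rho> where "0 < \<rho>"
    "\<And>x y. x \<in> X \<Longrightarrow> y \<in> X \<Longrightarrow> (\<And>n. dist (x n) (y n) < \<rho>) \<Longrightarrow> y \<in> N x \<eta>"
proof -
  obtain m \<rho> where \<rho>: "0 < \<rho>"
    "\<And>x y. x \<in> X \<Longrightarrow> y \<in> X \<Longrightarrow> dist (x m) (y m) < \<rho> \<Longrightarrow> dX x y < \<eta>"
    using dX_small[OF assms] by metis
  show thesis
  proof
    show "0 < min \<rho> \<eta>" using \<rho>(1) assms by simp
  next
    fix x y assume *: "x \<in> X" "y \<in> X" "\<And>n. dist (x n) (y n) < min \<rho> \<eta>"
    \<comment> \<open>Closeness in the single coordinate \<open>m\<close> already bounds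
      \<open>dX\<close>, so uniform closeness of coordinates yields both conditions in
      \<open>N\<close>.\<close>
    then have "dX x y < \<eta>" by (intro \<rho>(2)) auto
    then show "y \<in> N x \<eta>" using * by (auto simp: Xu_nbhd_def)
  qed
qed

lemma N_D: "y \<in> N x \<epsilon> \<Longrightarrow> y \<in> X" "y \<in> N x \<epsilon> \<Longrightarrow> dist (x n) (y n) < \<epsilon>"
  by (auto simp: Xu_nbhd_def)

lemma N_mono: "a \<le> b \<Longrightarrow> N x a \<subseteq> N x b"
  by (auto simp: Xu_nbhd_def intro: less_le_trans)

lemma N_self: "x \<in> X \<Longrightarrow> 0 < \<epsilon> \<Longrightarrow> x \<in> N x \<epsilon>"
  by (simp add: Xu_nbhd_def dX_eq_0)

text \<open>The first axiom is applied to the coordinates with index \<open>n + 2 * K\<close>, whose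
  images under \<open>g ^^ K\<close> and \<open>g ^^ (2 * K)\<close> are the coordinates
  \<open>n + K\<close> and \<open>n\<close>.\<close>

lemma unstable_contract:
  assumes "x \<in> X" "y \<in> X" "\<And>n. dist (x n) (y n) \<le> \<beta>"
  shows "dist (x (n + K)) (y (n + K)) \<le> \<gamma> ^ K * dist (x n) (y n)"
proof -
  have "(g ^^ K) (z (n + K + K)) = z (n + K)" "(g ^^ (2 * K)) (z (n + 2 * K)) = z n"
    if "z \<in> X" for z
    using inverse_limit_funpow[OF that] by auto
  then show ?thesis
    using axiom1[OF assms(3)[of "n + 2 * K"]] assms(1,2)
    by (simp add: mult_2 add.assoc)
qed

lemma unstable_contract_iter:
  assumes "x \<in> X" "y \<in> X" "\<And>n. dist (x n) (y n) \<le> \<beta>"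
  shows "dist (x (n + K * j)) (y (n + K * j)) \<le> (\<gamma> ^ K) ^ j * dist (x n) (y n)"
proof (induction j)
  case (Suc j)
  have "dist (x (n + K * Suc j)) (y (n + K * Suc j))
      \<le> \<gamma> ^ K * dist (x (n + K * j)) (y (n + K * j))"
    using unstable_contract[OF assms, of "n + K * j"] by (simp add: algebra_simps)
  also have "\<dots> \<le> \<gamma> ^ K * ((\<gamma> ^ K) ^ j * dist (x n) (y n))"
    using Suc \<gamma>_pos by (intro mult_left_mono) auto
  finally show ?case by (simp add: mult.assoc)
qed simp

text \<open>Contraction proceeds in steps of \<open>K\<close>, so each coordinate is controlled by
  the one below \<open>K\<close> in its residue class.\<close>

lemma unstable_dist_le_mod:
  assumes "x \<in> X" "y \<in> X" "\<And>n. dist (x n) (y n) \<le> \<beta>"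
  shows "dist (x n) (y n) \<le> (\<gamma> ^ K) ^ (n div K) * dist (x (n mod K)) (y (n mod K))"
  using unstable_contract_iter[OF assms, of "n mod K" "n div K"] by simp

lemma unstable_dist_le_mod':
  assumes "x \<in> X" "y \<in> X" "\<And>n. dist (x n) (y n) \<le> \<beta>"
  shows "dist (x n) (y n) \<le> dist (x (n mod K)) (y (n mod K))"
proof -
  have "(\<gamma> ^ K) ^ (n div K) \<le> 1" by (metis power_\<gamma>_le power_mult)
  then show ?thesis
    using unstable_dist_le_mod[OF assms, of n] mult_right_mono[of _ 1 "dist (x (n mod K)) (y (n mod K))"]
    by fastforce
qed

text \<open>The exponent \<open>n div K\<close> tends to infinity, so the geometric factor makes the
  uniform bound \<open>D\<close> vanish in the limit.\<close>

lemma unstable_dist_tendsto_0: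
  assumes "x \<in> X" "y \<in> X" "\<And>n. dist (x n) (y n) \<le> \<beta>"
  shows "(\<lambda>n. dist (x n) (y n)) \<longlonglongrightarrow> 0"
proof -
  obtain D where D: "0 < D" "\<And>x y::'a. dist x y \<le> D" using dist_bounded by metis
  have "filterlim (\<lambda>n. n div K) at_top sequentially"
    unfolding filterlim_at_top
  proof
    fix Z
    show "\<forall>\<^sub>F n in sequentially. Z \<le> n div K"
      using eventually_ge_at_top[of "Z * K"]
      by eventually_elim (use K_pos in \<open>simp add: less_eq_div_iff_mult_less_eq\<close>)
  qed
  moreover have "(\<lambda>j. (\<gamma> ^ K) ^ j) \<longlonglongrightarrow> 0"
    using \<gamma>_pos \<gamma>_less K_pos by (intro LIMSEQ_power_zero) (simp add: power_less_one_iff)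
  ultimately have lim: "(\<lambda>n. (\<gamma> ^ K) ^ (n div K)) \<longlonglongrightarrow> 0"
    by (rule filterlim_compose[rotated])
  show ?thesis
  proof (rule tendsto_sandwich[of "\<lambda>_. 0"])
    show "\<forall>\<^sub>F n in sequentially. dist (x n) (y n) \<le> (\<gamma> ^ K) ^ (n div K) * D"
    proof (rule always_eventually, rule allI)
      fix n
      have "(\<gamma> ^ K) ^ (n div K) * dist (x (n mod K)) (y (n mod K)) \<le> (\<gamma> ^ K) ^ (n div K) * D"
        using \<gamma>_pos D by (intro mult_left_mono) auto
      then show "dist (x n) (y n) \<le> (\<gamma> ^ K) ^ (n div K) * D"
        using unstable_dist_le_mod[OF assms, of n] by linarith
    qed
    show "(\<lambda>n. (\<gamma> ^ K) ^ (n div K) * D) \<longlonglongrightarrow> 0"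
      using tendsto_mult_right[OF lim, of D] by simp
  qed auto
qed

text \<open>Infinitely many strict inequalities need not leave a uniform margin. Here contraction
  reduces them to the first \<open>K\<close> coordinates, whose maximum \<open>m\<close> is still
  strictly below \<open>\<epsilon>\<close>.\<close>

lemma N_open:
  assumes "x \<in> X" "y \<in> N x \<epsilon>" "\<epsilon> \<le> \<beta>"
  obtains \<eta> where "0 < \<eta>" "N y \<eta> \<subseteq> N x \<epsilon>"
proof -
  have yX: "y \<in> X" and close: "\<And>n. dist (x n) (y n) < \<epsilon>" using assms(2) N_D by auto
  define m where "m = Max ((\<lambda>n. dist (x n) (y n)) ` {..<K})"
  have m: "m < \<epsilon>" unfolding m_def using close K_pos by (subst Max_less_iff) auto
  have le_m: "dist (x n) (y n) \<le> m" for n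
  proof -
    have "dist (x n) (y n) \<le> dist (x (n mod K)) (y (n mod K))"
      using unstable_dist_le_mod'[OF assms(1) yX] close assms(3)
      by (meson less_le_trans less_imp_le)
    also have "\<dots> \<le> m" unfolding m_def using K_pos by (intro Max_ge) auto
    finally show ?thesis .
  qed
  define \<eta> where "\<eta> = \<epsilon> - max m (dX x y)"
  have "dX x y < \<epsilon>" using assms(2) by (simp add: Xu_nbhd_def)
  then have "0 < \<eta>" using m by (simp add: \<eta>_def)
  moreover have "N y \<eta> \<subseteq> N x \<epsilon>"
  proof
    fix z assume z: "z \<in> N y \<eta>"
    have "dist (x n) (z n) < \<epsilon>" for n
      using le_m[of n] N_D(2)[OF z, of n] dist_triangle[of "x n" "z n" "y n"]
      unfolding \<eta>_def by linarith
    moreover have "dX y z < \<eta>" using z by (simp add: Xu_nbhd_def)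
    then have "dX x z < \<epsilon>"
      using dX_triangle[of x z y] unfolding \<eta>_def by linarith
    ultimately show "z \<in> N x \<epsilon>" using N_D(1)[OF z] by (simp add: Xu_nbhd_def)
  qed
  ultimately show thesis using that by blast
qed

text \<open>The first axiom, applied once, controls the \<open>K\<close>-th coordinate by the zeroth; the
  coordinates in between are its images, the later ones are controlled by contraction.\<close>

lemma zeroth_controls:
  assumes "0 < \<eta>"
  obtains \<rho> where "0 < \<rho>"
    "\<And>x y. x \<in> X \<Longrightarrow> y \<in> X \<Longrightarrow> (\<And>n. dist (x n) (y n) \<le> \<beta>) \<Longrightarrow> dist (x 0) (y 0) < \<rho> \<Longrightarrow> y \<in> N x \<eta>"
proof -
  obtain \<rho>1 where \<rho>1: "0 < \<rho>1"
    "\<And>x y. x \<in> X \<Longrightarrow> y \<in> X \<Longrightarrow> (\<And>n. dist (x n) (y n) < \<rho>1) \<Longrightarrow> y \<in> N x \<eta>"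
    using uniform_imp_N[OF assms] by metis
  obtain \<rho> where \<rho>: "0 < \<rho>"
    "\<And>j x y. j \<le> K \<Longrightarrow> dist x y < \<rho> \<Longrightarrow> dist ((g ^^ j) x) ((g ^^ j) y) < \<rho>1"
    using uniform_funpow[OF \<rho>1(1)] by metis
  have "y \<in> N x \<eta>"
    if x: "x \<in> X" and y: "y \<in> X" and \<beta>: "\<And>n. dist (x n) (y n) \<le> \<beta>" and 0: "dist (x 0) (y 0) < \<rho>"
    for x y
  proof (rule \<rho>1(2)[OF x y])
    fix n
    have "dist (x K) (y K) \<le> \<gamma> ^ K * dist (x 0) (y 0)"
      using unstable_contract[OF x y \<beta>, of 0] by simp
    also have "\<dots> < \<rho>"
      using 0 power_\<gamma>_le[of K] mult_right_mono[of "\<gamma> ^ K" 1 "dist (x 0) (y 0)"] by simp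
    finally have "dist ((g ^^ (K - n mod K)) (x K)) ((g ^^ (K - n mod K)) (y K)) < \<rho>1"
      by (intro \<rho>(2)) auto
    moreover have "(g ^^ (K - n mod K)) (z K) = z (n mod K)" if "z \<in> X" for z
      using inverse_limit_funpow[OF that, of "K - n mod K" "n mod K"] K_pos
      by (simp add: less_imp_le)
    ultimately show "dist (x n) (y n) < \<rho>1"
      using unstable_dist_le_mod'[OF x y \<beta>, of n] x y by simp
  qed
  then show thesis using that \<rho>(1) by blast
qed

text \<open>Dropping the zeroth coordinate of \<open>\<phi> x\<close> gives back \<open>x\<close>,
  so coordinatewise closeness survives, and \<open>uniform_imp_N\<close> restores the metric
  condition.\<close>

lemma N_shift:
  assumes "0 < \<eta>"
  obtains \<rho> where "0 < \<rho>"
    "\<And>x y. x \<in> X \<Longrightarrow> y \<in> N (\<phi> x) \<rho> \<Longrightarrow> (\<lambda>n. y (Suc n)) \<in> N x \<eta>"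
proof -
  obtain \<rho> where \<rho>: "0 < \<rho>"
    "\<And>x y. x \<in> X \<Longrightarrow> y \<in> X \<Longrightarrow> (\<And>n. dist (x n) (y n) < \<rho>) \<Longrightarrow> y \<in> N x \<eta>"
    using uniform_imp_N[OF assms] by metis
  have "(\<lambda>n. y (Suc n)) \<in> N x \<eta>" if "x \<in> X" and y: "y \<in> N (\<phi> x) \<rho>" for x y
    using \<rho>(2)[OF that(1), of "\<lambda>n. y (Suc n)"] N_D(2)[OF y, of "Suc _"]
      shift_in_inverse_limit[OF N_D(1)[OF y], of 1] by simp
  then show thesis using that \<rho>(1) by blast
qed

text \<open>Coordinates up to \<open>k\<close> of \<open>(\<phi> ^^ k) y\<close> are iterates of
  \<open>y 0\<close>, the later ones are coordinates of \<open>y\<close>; the two cases call for the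
  two radii in the minimum.\<close>

lemma N_funpow_\<phi>:
  assumes "0 < \<eta>"
  obtains \<rho> where "0 < \<rho>" "\<And>x y. x \<in> X \<Longrightarrow> y \<in> N x \<rho> \<Longrightarrow> (\<phi> ^^ k) y \<in> N ((\<phi> ^^ k) x) \<eta>"
proof -
  obtain \<rho>1 where \<rho>1: "0 < \<rho>1"
    "\<And>x y. x \<in> X \<Longrightarrow> y \<in> X \<Longrightarrow> (\<And>n. dist (x n) (y n) < \<rho>1) \<Longrightarrow> y \<in> N x \<eta>"
    using uniform_imp_N[OF assms] by metis
  obtain \<rho> where \<rho>: "0 < \<rho>"
    "\<And>j x y. j \<le> k \<Longrightarrow> dist x y < \<rho> \<Longrightarrow> dist ((g ^^ j) x) ((g ^^ j) y) < \<rho>1"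
    using uniform_funpow[OF \<rho>1(1)] by metis
  have "(\<phi> ^^ k) y \<in> N ((\<phi> ^^ k) x) \<eta>" if x: "x \<in> X" and y: "y \<in> N x (min \<rho> \<rho>1)" for x y
  proof (rule \<rho>1(2))
    fix n
    show "dist ((\<phi> ^^ k) x n) ((\<phi> ^^ k) y n) < \<rho>1"
      using N_D(2)[OF y, of 0] N_D(2)[OF y, of "n - k"] \<rho>(2)[of "k - n" "x 0" "y 0"]
      by (auto simp: funpow_limit_shift)
  qed (use x N_D(1)[OF y] funpow_\<phi>_in in auto)
  then show thesis using that[of "min \<rho> \<rho>1"] \<rho>(1) \<rho>1(1) by auto
qed

text \<open>The inverse shifts pass to tails. The zeroth coordinate of the tails gives one
  direction; for the other, \<open>dX_small\<close> reduces \<open>dX\<close> of the tails to their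
  coordinate \<open>m\<close>.\<close>

lemma unstable_equiv_iff:
  assumes "x \<in> X" "y \<in> X"
  shows "unstable_equiv g K \<gamma> x y \<longleftrightarrow> (\<lambda>n. dist (x n) (y n)) \<longlonglongrightarrow> 0"
proof -
  have eq: "unstable_equiv g K \<gamma> x y \<longleftrightarrow> (\<lambda>n. dX (\<lambda>m. x (m + n)) (\<lambda>m. y (m + n))) \<longlonglongrightarrow> 0"
    unfolding unstable_equiv_def Let_def
    by (simp add: funpow_inv_into_limit_shift assms)
  have "(\<lambda>n. dist (x n) (y n)) \<longlonglongrightarrow> 0"
    if "(\<lambda>n. dX (\<lambda>m. x (m + n)) (\<lambda>m. y (m + n))) \<longlonglongrightarrow> 0"
  proof (rule tendsto_sandwich[OF _ _ tendsto_const that])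
    show "\<forall>\<^sub>F n in sequentially. dist (x n) (y n) \<le> dX (\<lambda>m. x (m + n)) (\<lambda>m. y (m + n))"
      using dist_le_dX[of 0 "\<lambda>m. x (m + _)" "\<lambda>m. y (m + _)"] by (auto intro: always_eventually)
  qed auto
  moreover have "(\<lambda>n. dX (\<lambda>m. x (m + n)) (\<lambda>m. y (m + n))) \<longlonglongrightarrow> 0"
    if lim: "(\<lambda>n. dist (x n) (y n)) \<longlonglongrightarrow> 0"
  proof (rule LIMSEQ_I)
    fix \<epsilon> :: real assume "0 < \<epsilon>"
    then obtain m \<rho> where \<rho>: "0 < \<rho>"
      "\<And>x y. x \<in> X \<Longrightarrow> y \<in> X \<Longrightarrow> dist (x m) (y m) < \<rho> \<Longrightarrow> dX x y < \<epsilon>"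
      using dX_small by metis
    obtain n0 where n0: "\<And>n. n \<ge> n0 \<Longrightarrow> dist (x n) (y n) < \<rho>"
      using LIMSEQ_D[OF lim \<rho>(1)] by auto
    have "dX (\<lambda>m. x (m + n)) (\<lambda>m. y (m + n)) < \<epsilon>" if "n \<ge> n0" for n
      using n0[of "m + n"] that
      by (intro \<rho>(2) shift_in_inverse_limit assms) auto
    then show "\<exists>n0. \<forall>n\<ge>n0. norm (dX (\<lambda>m. x (m + n)) (\<lambda>m. y (m + n)) - 0) < \<epsilon>"
      using dX_nonneg by auto
  qed
  ultimately show ?thesis using eq by blast
qed

text \<open>By the second axiom \<open>y\<close> can be replaced by a point with the same image under \<open>g ^^ K\<close>
  that lifts to a whole history staying close to \<open>x\<close>.\<close>

lemma local_lift:
  assumes "0 < \<eta>"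
  obtains \<rho> where "0 < \<rho>"
    "\<And>x y. x \<in> X \<Longrightarrow> dist (x 0) y < \<rho> \<Longrightarrow> \<exists>z\<in>N x \<eta>. (g ^^ K) (z 0) = (g ^^ K) y"
proof -
  obtain \<rho>1 where \<rho>1: "0 < \<rho>1"
    "\<And>x y. x \<in> X \<Longrightarrow> y \<in> X \<Longrightarrow> (\<And>n. dist (x n) (y n) < \<rho>1) \<Longrightarrow> y \<in> N x \<eta>"
    using uniform_imp_N[OF assms] by metis
  obtain \<rho>2 where \<rho>2: "0 < \<rho>2"
    "\<And>j x y. j \<le> 2 * K \<Longrightarrow> dist x y < \<rho>2 \<Longrightarrow> dist ((g ^^ j) x) ((g ^^ j) y) < \<rho>1"
    using uniform_funpow[OF \<rho>1(1)] by metis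
  define \<rho> where "\<rho> = min \<rho>2 \<beta>"
  have \<rho>: "0 < \<rho>" "\<rho> \<le> \<beta>" "\<rho> \<le> \<rho>2" using \<rho>2(1) \<beta>_pos by (auto simp: \<rho>_def)
  have "\<exists>z\<in>N x \<eta>. (g ^^ K) (z 0) = (g ^^ K) y" if x: "x \<in> X" and xy: "dist (x 0) y < \<rho>" for x y
  proof -
    \<comment> \<open>The second axiom at \<open>x (K * Suc j)\<close> gives a preimage only up to
      \<open>g ^^ K\<close>: \<open>w'\<close> satisfies
      \<open>(g ^^ (2 * K)) w' = (g ^^ K) w\<close>, not necessarily
      \<open>(g ^^ K) w' = w\<close>.\<close>
    have step: "\<exists>w'. dist (x (K * Suc j)) w' < \<rho> \<and> (g ^^ (2 * K)) w' = (g ^^ K) w"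
      if "dist (x (K * j)) w < \<rho>" for j w
    proof -
      have "(g ^^ K) (x (K * Suc j)) = x (K * j)"
        using inverse_limit_funpow[OF x, of K "K * j"] by (simp add: add.commute)
      then have "(g ^^ K) w \<in> (g ^^ K) ` ball ((g ^^ K) (x (K * Suc j))) \<rho>"
        using that by (intro imageI) simp
      then have "(g ^^ K) w \<in> (g ^^ (2 * K)) ` ball (x (K * Suc j)) (\<gamma> * \<rho>)"
        using axiom2[OF \<rho>(1,2)] by blast
      then obtain w' where "dist (x (K * Suc j)) w' < \<gamma> * \<rho>" "(g ^^ (2 * K)) w' = (g ^^ K) w"
        by (metis imageE mem_ball)
      moreover have "\<gamma> * \<rho> \<le> \<rho>" using \<gamma>_less \<rho>(1) by simp
      ultimately show ?thesis by (intro exI[of _ w']) linarith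
    qed
    define w where "w = rec_nat y
      (\<lambda>j v. SOME w'. dist (x (K * Suc j)) w' < \<rho> \<and> (g ^^ (2 * K)) w' = (g ^^ K) v)"
    have w_0: "w 0 = y" by (simp add: w_def)
    have w_close: "dist (x (K * j)) (w j) < \<rho>" for j
    proof (induction j)
      case 0
      then show ?case using xy w_0 by simp
    next
      case (Suc j)
      then show ?case using someI_ex[OF step[OF Suc]] by (simp add: w_def)
    qed
    have w_rel: "(g ^^ (2 * K)) (w (Suc j)) = (g ^^ K) (w j)" for j
      using someI_ex[OF step[OF w_close[of j]]] by (simp add: w_def)
    \<comment> \<open>Applying \<open>g ^^ K\<close> once to the \<open>w\<close> sequence turns its
      weak relation into a genuine history under \<open>g ^^ K\<close>.\<close>
    define v where "v j = (g ^^ K) (w (Suc j))" for j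
    have v_rel: "(g ^^ K) (v (Suc j)) = v j" for j
      using w_rel[of "Suc j"] by (simp add: v_def mult_2 funpow_add)
    \<comment> \<open>\<open>z\<close> has the value \<open>v j\<close> at index
      \<open>K * j\<close> and fills the gaps with images under \<open>g\<close>.\<close>
    define z where "z n = (g ^^ (K - n mod K)) (v (Suc (n div K)))" for n
    have "z \<in> X"
    proof -
      have "g (z (Suc n)) = z n" for n
      \<comment> \<open>The first case crosses into the next block, where the exponent drops to 1 at
        \<open>n\<close> and returns to \<open>K\<close> at \<open>Suc n\<close>.\<close>
      proof (cases "Suc (n mod K) = K")
        case True
        then have "Suc n mod K = 0" "Suc n div K = Suc (n div K)"
          by (auto simp: mod_Suc div_Suc)
        moreover have "K - n mod K = Suc 0" using True by linarith
        ultimately show ?thesis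
          using v_rel[of "Suc (n div K)"] by (simp add: z_def)
      next
        case False
        then have "Suc n mod K = Suc (n mod K)" "Suc n div K = n div K"
          by (auto simp: mod_Suc div_Suc)
        moreover have "K - n mod K = Suc (K - Suc (n mod K))"
          using mod_less_divisor[OF K_pos, of n] False by linarith
        ultimately show ?thesis by (simp add: z_def)
      qed
      then show ?thesis by (simp add: inverse_limit_def)
    qed
    moreover have "dist (x n) (z n) < \<rho>1" for n
    proof -
      \<comment> \<open>With this \<open>j\<close> and \<open>e \<le> 2 * K\<close>, both
        \<open>x n\<close> and \<open>z n\<close> are images under \<open>g ^^ e\<close>, namely of
        the close points \<open>x (K * j)\<close> and \<open>w j\<close>.\<close>
      define j where "j = Suc (Suc (n div K))"
      define e where "e = 2 * K - n mod K"
      have "z n = (g ^^ e) (w j)"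
      proof -
        have "e = (K - n mod K) + K"
          using mod_less_divisor[OF K_pos, of n] unfolding e_def by linarith
        then show ?thesis by (simp add: z_def v_def j_def funpow_add)
      qed
      moreover have "n + e = K * j"
      proof -
        have "n + e = n div K * K + n mod K + (2 * K - n mod K)" by (simp add: e_def)
        also have "\<dots> = n div K * K + 2 * K"
          using mod_less_divisor[OF K_pos, of n] by linarith
        finally show ?thesis by (simp add: j_def algebra_simps)
      qed
      then have "x n = (g ^^ e) (x (K * j))" using inverse_limit_funpow[OF x, of e n] by simp
      ultimately show ?thesis
        using \<rho>2(2)[of e "x (K * j)" "w j"] w_close[of j] \<rho>(3) by (simp add: e_def)
    qed
    ultimately have "z \<in> N x \<eta>" using \<rho>1(2)[OF x] by blast
    moreover have "(g ^^ K) (z 0) = (g ^^ K) y"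
      using v_rel[of 0] w_rel[of 0] w_0 by (simp add: z_def v_def mult_2 funpow_add)
    ultimately show ?thesis by blast
  qed
  then show thesis using that \<rho>(1) by blast
qed

text \<open>On \<open>X\<^sup>u(P)\<close> the symmetric part of this preorder is \<^const>\<open>rel0\<close>.\<close>

definition germ_le :: "(nat \<Rightarrow> 'a) \<Rightarrow> (nat \<Rightarrow> 'a) \<Rightarrow> bool" where
  "germ_le x y \<longleftrightarrow> x 0 = y 0 \<and>
     (\<forall>\<epsilon>>0. \<exists>\<delta>>0. (\<lambda>z. z 0) ` N x \<delta> \<subseteq> (\<lambda>z. z 0) ` N y \<epsilon>)"

section \<open>Comparing germs of projected leaf neighbourhoods\<close>

lemma germ_le_refl: "germ_le x x"
  unfolding germ_le_def by blast

lemma germ_le_trans: "germ_le x y \<Longrightarrow> germ_le y z \<Longrightarrow> germ_le x z"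
  unfolding germ_le_def by (auto, meson order_trans)

text \<open>One pair of radii is enough: a point of \<open>N y \<epsilon>\<close> over a value close
  to \<open>y 0\<close> lies in any prescribed \<open>N y \<eta>\<close> by
  \<open>zeroth_controls\<close>, whose hypothesis comes from
  \<open>\<epsilon> \<le> \<beta>\<close>.\<close>

lemma germ_leI:
  assumes "x \<in> X" "y \<in> X" "x 0 = y 0" "0 < \<delta>" "\<epsilon> \<le> \<beta>"
    and sub: "(\<lambda>z. z 0) ` N x \<delta> \<subseteq> (\<lambda>z. z 0) ` N y \<epsilon>"
  shows "germ_le x y"
  unfolding germ_le_def
proof (intro conjI allI impI)
  show "x 0 = y 0" by fact
  fix \<eta> :: real assume "0 < \<eta>"
  then obtain \<rho> where \<rho>: "0 < \<rho>"
    "\<And>x y. x \<in> X \<Longrightarrow> y \<in> X \<Longrightarrow> (\<And>n. dist (x n) (y n) \<le> \<beta>) \<Longrightarrow> dist (x 0) (y 0) < \<rho> \<Longrightarrow> y \<in> N x \<eta>"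
    using zeroth_controls by metis
  have "(\<lambda>z. z 0) ` N x (min \<delta> \<rho>) \<subseteq> (\<lambda>z. z 0) ` N y \<eta>"
  proof clarify
    fix z assume z: "z \<in> N x (min \<delta> \<rho>)"
    then have "z \<in> N x \<delta>" using N_mono[of "min \<delta> \<rho>" \<delta> x] by auto
    then have "z 0 \<in> (\<lambda>z. z 0) ` N y \<epsilon>" using sub by blast
    then obtain w where w: "w \<in> N y \<epsilon>" "w 0 = z 0" by auto
    have "dist (y n) (w n) \<le> \<beta>" for n using N_D(2)[OF w(1), of n] assms(5) by linarith
    moreover have "dist (y 0) (w 0) < \<rho>" using N_D(2)[OF z, of 0] w(2) assms(3) by simp
    ultimately have "w \<in> N y \<eta>" using \<rho>(2) N_D(1)[OF w(1)] assms(2) by blast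
    then show "z 0 \<in> (\<lambda>z. z 0) ` N y \<eta>" using w(2) by (metis imageI)
  qed
  moreover have "0 < min \<delta> \<rho>" using assms(4) \<rho>(1) by simp
  ultimately show "\<exists>\<delta>>0. (\<lambda>z. z 0) ` N x \<delta> \<subseteq> (\<lambda>z. z 0) ` N y \<eta>" by blast
qed

text \<open>A point \<open>z\<close> near \<open>\<phi> x\<close> is shifted back to the leaf of
  \<open>x\<close>; there \<open>z 1\<close> is matched by some \<open>w\<close> near
  \<open>y\<close>, and \<open>\<phi> w\<close> then lies over \<open>g (z 1) = z 0\<close>.\<close>

lemma germ_le_\<phi>:
  assumes "x \<in> X" "y \<in> X" "germ_le x y"
  shows "germ_le (\<phi> x) (\<phi> y)"
  unfolding germ_le_def
proof (intro conjI allI impI)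
  show "\<phi> x 0 = \<phi> y 0" using assms(3) by (simp add: germ_le_def)
  fix \<epsilon> :: real assume "0 < \<epsilon>"
  then obtain \<epsilon>1 where \<epsilon>1: "0 < \<epsilon>1" "\<And>x y. x \<in> X \<Longrightarrow> y \<in> N x \<epsilon>1 \<Longrightarrow> \<phi> y \<in> N (\<phi> x) \<epsilon>"
    using N_funpow_\<phi>[where k = "Suc 0", OF \<open>0 < \<epsilon>\<close>, simplified] by metis
  obtain \<delta>1 where \<delta>1: "0 < \<delta>1" "(\<lambda>z. z 0) ` N x \<delta>1 \<subseteq> (\<lambda>z. z 0) ` N y \<epsilon>1"
    using assms(3) \<epsilon>1(1) unfolding germ_le_def by blast
  obtain \<delta> where \<delta>: "0 < \<delta>"
    "\<And>x y. x \<in> X \<Longrightarrow> y \<in> N (\<phi> x) \<delta> \<Longrightarrow> (\<lambda>n. y (Suc n)) \<in> N x \<delta>1"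
    using N_shift[OF \<delta>1(1)] by metis
  have "(\<lambda>z. z 0) ` N (\<phi> x) \<delta> \<subseteq> (\<lambda>z. z 0) ` N (\<phi> y) \<epsilon>"
  proof clarify
    fix z assume z: "z \<in> N (\<phi> x) \<delta>"
    have "z 1 \<in> (\<lambda>z. z 0) ` N x \<delta>1"
      using \<delta>(2)[OF assms(1) z] by (rule rev_image_eqI) simp
    then obtain w where w: "w \<in> N y \<epsilon>1" "w 0 = z 1" using \<delta>1(2) by auto
    have "g (z 1) = z 0" using N_D(1)[OF z] by (simp add: inverse_limit_def)
    then have "\<phi> w 0 = z 0" using w(2) by simp
    then show "z 0 \<in> (\<lambda>z. z 0) ` N (\<phi> y) \<epsilon>" using \<epsilon>1(2)[OF assms(2) w(1)] by (metis imageI)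
  qed
  then show "\<exists>\<delta>>0. (\<lambda>z. z 0) ` N (\<phi> x) \<delta> \<subseteq> (\<lambda>z. z 0) ` N (\<phi> y) \<epsilon>" using \<delta>(1) by blast
qed

end

section \<open>The quotient of the unstable set\<close>

locale wieler_quotient = wieler +
  fixes P :: "(nat \<Rightarrow> 'a) set" and \<epsilon>Y :: real
  assumes P_sub: "P \<subseteq> X"
    and P_inv: "\<phi> ` P \<subseteq> P"
    and epsY: "0 < \<epsilon>Y" "\<epsilon>Y \<le> \<beta> / 2"
    and pi0_inj: "\<forall>z\<in>Xu g K \<gamma> P. inj_on (\<lambda>x. x 0) (N z \<epsilon>Y)"
begin

abbreviation XuP where "XuP \<equiv> Xu g K \<gamma> P"
abbreviation TXu where "TXu \<equiv> Xu_topology g \<beta> K \<gamma> P"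
abbreviation R0 where "R0 \<equiv> rel0 g \<beta> K \<gamma> P \<epsilon>Y"
abbreviation Q where "Q \<equiv> Xu_quot g \<beta> K \<gamma> P \<epsilon>Y"
abbreviation gt where "gt \<equiv> gtilde g \<beta> K \<gamma> P \<epsilon>Y"
abbreviation TQ where "TQ \<equiv> quotient_topology TXu R0"

lemma XuP_subset: "x \<in> XuP \<Longrightarrow> x \<in> X"
  by (simp add: Xu_def)

lemma Xu_iff: "x \<in> XuP \<longleftrightarrow> x \<in> X \<and> (\<exists>p\<in>P. (\<lambda>n. dist (x n) (p n)) \<longlonglongrightarrow> 0)"
  unfolding Xu_def using P_sub by (auto simp: unstable_equiv_iff subset_iff)

lemma \<phi>_Xu: assumes "x \<in> XuP" shows "\<phi> x \<in> XuP"
proof -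
  obtain p where p: "p \<in> P" "(\<lambda>n. dist (x n) (p n)) \<longlonglongrightarrow> 0" using assms Xu_iff by blast
  have "(\<lambda>n. dist (\<phi> x (Suc n)) (\<phi> p (Suc n))) \<longlonglongrightarrow> 0" using p(2) by simp
  then have "(\<lambda>n. dist (\<phi> x n) (\<phi> p n)) \<longlonglongrightarrow> 0" by (rule LIMSEQ_imp_Suc)
  then show ?thesis using p(1) P_inv XuP_subset[OF assms] \<phi>_in Xu_iff by blast
qed

lemma funpow_\<phi>_Xu: "x \<in> XuP \<Longrightarrow> (\<phi> ^^ k) x \<in> XuP"
  by (induction k) (auto intro: \<phi>_Xu)

text \<open>Points of the solenoid within \<open>\<beta>\<close> in every coordinate are asymptotic
  by contraction, so they share the same \<open>p\<close>.\<close>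

lemma N_subset_Xu:
  assumes "x \<in> XuP" "\<epsilon> \<le> \<beta>"
  shows "N x \<epsilon> \<subseteq> XuP"
proof
  fix y assume y: "y \<in> N x \<epsilon>"
  obtain p where p: "p \<in> P" "(\<lambda>n. dist (x n) (p n)) \<longlonglongrightarrow> 0" using assms Xu_iff by blast
  have "dist (x n) (y n) \<le> \<beta>" for n using N_D(2)[OF y, of n] assms(2) by linarith
  then have "(\<lambda>n. dist (x n) (y n)) \<longlonglongrightarrow> 0"
    using unstable_dist_tendsto_0 XuP_subset[OF assms(1)] N_D(1)[OF y] by blast
  then have "(\<lambda>n. dist (x n) (y n) + dist (x n) (p n)) \<longlonglongrightarrow> 0"
    using tendsto_add[OF _ p(2)] by fastforce
  then have "(\<lambda>n. dist (y n) (p n)) \<longlonglongrightarrow> 0"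
    by (rule tendsto_sandwich[OF _ _ tendsto_const, rotated 2])
      (auto intro!: always_eventually dist_triangle3)
  then show "y \<in> XuP" using p(1) N_D(1)[OF y] Xu_iff by blast
qed

text \<open>Shrinking a radius preserves the inclusion, so the bound \<open>\<beta> / 2\<close> can
  always be restored.\<close>

lemma openin_Xu_iff:
  "openin TXu U \<longleftrightarrow> U \<subseteq> XuP \<and> (\<forall>x\<in>U. \<exists>\<epsilon>>0. N x \<epsilon> \<subseteq> U)"
proof -
  have "\<exists>\<epsilon>'>0. \<epsilon>' \<le> \<beta> / 2 \<and> N x \<epsilon>' \<subseteq> U" if "0 < \<epsilon>" "N x \<epsilon> \<subseteq> U" for x \<epsilon>
    using that N_mono[of "min \<epsilon> (\<beta> / 2)" \<epsilon> x] \<beta>_pos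
    by (intro exI[of _ "min \<epsilon> (\<beta> / 2)"]) auto
  then show ?thesis unfolding openin_Xu_topology by blast
qed

lemma topspace_Xu: "topspace TXu = XuP"
proof -
  have "openin TXu XuP"
    unfolding openin_Xu_iff using N_subset_Xu \<beta>_pos by blast
  moreover have "topspace TXu \<subseteq> XuP"
    using openin_topspace[of TXu] unfolding openin_Xu_iff by (rule conjunct1)
  ultimately show ?thesis by (intro equalityI openin_subset)
qed

lemma topspace_Q: "topspace TQ = Q"
  by (simp add: topspace_quotient_topology topspace_Xu Xu_quot_def)

text \<open>One direction is the inclusion of \<open>U\<close> in \<open>N y \<epsilon>Y\<close>.
  For the other, injectivity of the projection forces the point of \<open>U\<close> over
  \<open>y 0\<close> to be \<open>y\<close>, so \<open>U\<close> contains a neighbourhood of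
  \<open>y\<close>.\<close>

lemma rel0_imp_germ_le:
  assumes "(x, y) \<in> R0"
  shows "germ_le x y" "germ_le y x"
proof -
  obtain \<delta> U where x: "x \<in> XuP" and y: "y \<in> XuP" and 0: "x 0 = y 0" and \<delta>: "0 < \<delta>" "\<delta> < \<epsilon>Y"
    and U: "openin TXu U" "U \<subseteq> N y \<epsilon>Y" and eq: "(\<lambda>z. z 0) ` N x \<delta> = (\<lambda>z. z 0) ` U"
    using assms unfolding rel0_def by blast
  have \<epsilon>\<beta>: "\<epsilon>Y \<le> \<beta>" using epsY by simp
  show "germ_le x y"
    using germ_leI[OF XuP_subset[OF x] XuP_subset[OF y] 0 \<delta>(1) \<epsilon>\<beta>] eq U(2) by blast
  have "x 0 \<in> (\<lambda>z. z 0) ` U" using N_self[OF XuP_subset[OF x] \<delta>(1)] eq by blast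
  then obtain u where u: "u \<in> U" "u 0 = y 0" using 0 by auto
  then have "u = y"
    using pi0_inj y U(2) N_self[OF XuP_subset[OF y] epsY(1)] unfolding inj_on_def by blast
  then obtain \<delta>' where "0 < \<delta>'" "N y \<delta>' \<subseteq> U" using u U(1) openin_Xu_iff by blast
  then show "germ_le y x"
    using germ_leI[OF XuP_subset[OF y] XuP_subset[OF x] 0[symmetric], of \<delta>' \<delta>] eq \<epsilon>\<beta> \<delta>(2) by auto
qed

lemma germ_le_imp_rel0:
  assumes x: "x \<in> XuP" and y: "y \<in> XuP" and "germ_le x y" "germ_le y x"
  shows "(x, y) \<in> R0"
proof -
  obtain \<epsilon>' where \<epsilon>': "0 < \<epsilon>'" "(\<lambda>z. z 0) ` N y \<epsilon>' \<subseteq> (\<lambda>z. z 0) ` N x \<epsilon>Y"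
    using assms(4) epsY(1) unfolding germ_le_def by blast
  define \<epsilon>1 where "\<epsilon>1 = min \<epsilon>' \<epsilon>Y"
  have \<epsilon>1: "0 < \<epsilon>1" "\<epsilon>1 \<le> \<epsilon>Y" "\<epsilon>1 \<le> \<beta>" "(\<lambda>z. z 0) ` N y \<epsilon>1 \<subseteq> (\<lambda>z. z 0) ` N x \<epsilon>Y"
    using \<epsilon>' epsY N_mono[of \<epsilon>1 \<epsilon>' y] by (auto simp: \<epsilon>1_def)
  obtain \<delta>' where \<delta>': "0 < \<delta>'" "(\<lambda>z. z 0) ` N x \<delta>' \<subseteq> (\<lambda>z. z 0) ` N y \<epsilon>1"
    using assms(3) \<epsilon>1(1) unfolding germ_le_def by blast
  \<comment> \<open>Halving \<open>\<epsilon>Y\<close> secures the strict inequality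
    \<open>\<delta> < \<epsilon>Y\<close> demanded by \<open>rel0\<close>.\<close>
  define \<delta> where "\<delta> = min \<delta>' (\<epsilon>Y / 2)"
  have \<delta>: "0 < \<delta>" "\<delta> < \<epsilon>Y" "\<delta> \<le> \<beta>" "(\<lambda>z. z 0) ` N x \<delta> \<subseteq> (\<lambda>z. z 0) ` N y \<epsilon>1"
    using \<delta>' epsY N_mono[of \<delta> \<delta>' x] by (auto simp: \<delta>_def)
  \<comment> \<open>\<open>U\<close> is the part of \<open>N y \<epsilon>1\<close> over the image of
    \<open>N x \<delta>\<close>. The real work is its openness: nearby points of the leaf of
    \<open>y\<close> must still lie over \<open>N x \<delta>\<close>.\<close>
  define U where "U = {u \<in> N y \<epsilon>1. u 0 \<in> (\<lambda>z. z 0) ` N x \<delta>}"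
  have "openin TXu U"
    unfolding openin_Xu_iff
  proof (intro conjI ballI)
    show "U \<subseteq> XuP" using N_subset_Xu[OF y \<epsilon>1(3)] by (auto simp: U_def)
    fix u assume "u \<in> U"
    then obtain v where u: "u \<in> N y \<epsilon>1" and v: "v \<in> N x \<delta>" "u 0 = v 0" by (auto simp: U_def)
    obtain \<eta>1 where \<eta>1: "0 < \<eta>1" "N u \<eta>1 \<subseteq> N y \<epsilon>1"
      using N_open[OF XuP_subset[OF y] u \<epsilon>1(3)] by blast
    obtain \<eta>2 where \<eta>2: "0 < \<eta>2" "N v \<eta>2 \<subseteq> N x \<delta>"
      using N_open[OF XuP_subset[OF x] v(1) \<delta>(3)] by blast
    obtain \<rho> where \<rho>: "0 < \<rho>"
      "\<And>x y. x \<in> X \<Longrightarrow> y \<in> X \<Longrightarrow> (\<And>n. dist (x n) (y n) \<le> \<beta>) \<Longrightarrow> dist (x 0) (y 0) < \<rho> \<Longrightarrow>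
         y \<in> N x \<eta>2"
      using zeroth_controls[OF \<eta>2(1)] by metis
    have "N u (min \<eta>1 \<rho>) \<subseteq> U"
    proof
      fix u' assume u': "u' \<in> N u (min \<eta>1 \<rho>)"
      then have u'y: "u' \<in> N y \<epsilon>1" using \<eta>1(2) N_mono[of "min \<eta>1 \<rho>" \<eta>1 u] by auto
      then obtain v' where v': "v' \<in> N x \<epsilon>Y" "u' 0 = v' 0" using \<epsilon>1(4) by auto
      \<comment> \<open>Both points are near \<open>x\<close>, and
        \<open>\<delta> + \<epsilon>Y < 2 * \<epsilon>Y \<le> \<beta>\<close> brings them within
        reach of \<open>zeroth_controls\<close>.\<close>
      have "dist (v n) (v' n) \<le> \<beta>" for n
        using N_D(2)[OF v(1), of n] N_D(2)[OF v'(1), of n] dist_triangle3[of "v n" "v' n" "x n"]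
          \<delta>(2) epsY(2) by linarith
      moreover have "dist (v 0) (v' 0) < \<rho>" using N_D(2)[OF u', of 0] v(2) v'(2) by simp
      ultimately have "v' \<in> N v \<eta>2" using \<rho>(2) N_D(1)[OF v(1)] N_D(1)[OF v'(1)] by blast
      then show "u' \<in> U" using \<eta>2(2) u'y v'(2) by (auto simp: U_def)
    qed
    then show "\<exists>\<epsilon>>0. N u \<epsilon> \<subseteq> U" using \<eta>1(1) \<rho>(1) by (intro exI[of _ "min \<eta>1 \<rho>"]) auto
  qed
  moreover have "U \<subseteq> N y \<epsilon>Y" using N_mono[OF \<epsilon>1(2), of y] by (auto simp: U_def)
  moreover have "(\<lambda>z. z 0) ` N x \<delta> = (\<lambda>z. z 0) ` U"
  proof
    show "(\<lambda>z. z 0) ` N x \<delta> \<subseteq> (\<lambda>z. z 0) ` U"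
    proof
      fix a assume a: "a \<in> (\<lambda>z. z 0) ` N x \<delta>"
      then obtain u where "u \<in> N y \<epsilon>1" "a = u 0" using \<delta>(4) by blast
      then show "a \<in> (\<lambda>z. z 0) ` U" using a by (auto simp: U_def)
    qed
  qed (auto simp: U_def)
  moreover have "x 0 = y 0" using assms(3) by (simp add: germ_le_def)
  ultimately show ?thesis using x y \<delta>(1,2) unfolding rel0_def by blast
qed

lemma rel0_iff: "(x, y) \<in> R0 \<longleftrightarrow> x \<in> XuP \<and> y \<in> XuP \<and> germ_le x y \<and> germ_le y x"
proof -
  have "x \<in> XuP \<and> y \<in> XuP" if "(x, y) \<in> R0" using that by (auto simp: rel0_def)
  then show ?thesis using rel0_imp_germ_le germ_le_imp_rel0 by blast
qed

lemma equiv_rel0: "equiv XuP R0"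
  by (rule equivI)
    (auto simp: refl_on_def sym_def trans_def rel0_iff germ_le_refl intro: germ_le_trans)

lemma rel0_zeroth: "(x, y) \<in> R0 \<Longrightarrow> x 0 = y 0"
  by (simp add: rel0_def)

lemma rel0_\<phi>: "(x, y) \<in> R0 \<Longrightarrow> (\<phi> x, \<phi> y) \<in> R0"
  using \<phi>_Xu germ_le_\<phi> XuP_subset by (auto simp: rel0_iff)

abbreviation cls where "cls x \<equiv> R0 `` {x}"

lemma cls_eqI: "(x, y) \<in> R0 \<Longrightarrow> cls x = cls y"
  by (rule equiv_class_eq[OF equiv_rel0])

lemma self_in_cls: "x \<in> XuP \<Longrightarrow> x \<in> cls x"
  by (rule equiv_class_self[OF equiv_rel0])

lemma cls_in_Q: "x \<in> XuP \<Longrightarrow> cls x \<in> Q"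
  unfolding Xu_quot_def by (rule quotientI)

lemma Q_cases: assumes "c \<in> Q" obtains x where "x \<in> XuP" "c = cls x"
  using assms unfolding Xu_quot_def by (auto elim: quotientE)

lemma rmap_cls: assumes "x \<in> XuP" shows "rmap (cls x) = x 0"
  unfolding rmap_def using self_in_cls[OF assms]
  by (intro the_elem_image_unique) (auto dest: rel0_zeroth)

lemma gtilde_cls: assumes "x \<in> XuP" shows "gt (cls x) = cls (\<phi> x)"
  unfolding gtilde_def
proof (rule the_elem_image_unique)
  show "cls x \<noteq> {}" using self_in_cls[OF assms] by blast
  show "cls (\<phi> y) = cls (\<phi> x)" if "y \<in> cls x" for y
    using that by (intro cls_eqI[symmetric] rel0_\<phi>) simp
qed

lemma funpow_gtilde_cls: "x \<in> XuP \<Longrightarrow> (gt ^^ k) (cls x) = cls ((\<phi> ^^ k) x)"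
  by (induction k) (auto simp: gtilde_cls funpow_\<phi>_Xu)

lemma gtilde_in_Q: "c \<in> Q \<Longrightarrow> gt c \<in> Q"
  by (metis Q_cases gtilde_cls cls_in_Q \<phi>_Xu)

lemma rmap_gtilde: "c \<in> Q \<Longrightarrow> rmap (gt c) = g (rmap c)"
  by (metis Q_cases gtilde_cls rmap_cls \<phi>_Xu limit_shift_0)

text \<open>Pulled back to \<open>XuP\<close>, \<open>rmap\<close> is the zeroth coordinate, which
  is continuous because \<open>N x \<epsilon>\<close> bounds every coordinate distance by
  \<open>\<epsilon>\<close>.\<close>

lemma continuous_map_rmap: "continuous_map TQ euclidean rmap"
  unfolding continuous_map_def topspace_Q
proof (intro conjI allI impI)
  fix U :: "'a set" assume U: "openin euclidean U"
  have "openin TXu {x \<in> XuP. cls x \<in> {c \<in> Q. rmap c \<in> U}}"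
    unfolding openin_Xu_iff
  proof (intro conjI ballI)
    fix x assume "x \<in> {x \<in> XuP. cls x \<in> {c \<in> Q. rmap c \<in> U}}"
    then have x: "x \<in> XuP" "x 0 \<in> U" using rmap_cls by auto
    then obtain e where e: "0 < e" "\<And>y. dist y (x 0) < e \<Longrightarrow> y \<in> U"
      using U unfolding open_openin[symmetric] open_dist by blast
    have "N x (min e \<beta>) \<subseteq> {x \<in> XuP. cls x \<in> {c \<in> Q. rmap c \<in> U}}"
    proof
      fix y assume y: "y \<in> N x (min e \<beta>)"
      then have "y \<in> XuP" using N_subset_Xu[OF x(1), of "min e \<beta>"] by auto
      moreover have "y 0 \<in> U" using e(2) N_D(2)[OF y, of 0] by (simp add: dist_commute)
      ultimately show "y \<in> {x \<in> XuP. cls x \<in> {c \<in> Q. rmap c \<in> U}}"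
        by (simp add: rmap_cls cls_in_Q)
    qed
    then show "\<exists>\<epsilon>>0. N x \<epsilon> \<subseteq> {x \<in> XuP. cls x \<in> {c \<in> Q. rmap c \<in> U}}"
      using e(1) \<beta>_pos by (intro exI[of _ "min e \<beta>"]) auto
  qed auto
  then show "openin TQ {c \<in> Q. rmap c \<in> U}"
    by (auto simp: openin_quotient_topology topspace_Xu Xu_quot_def)
qed auto

end

section \<open>The map \<open>s\<close> and the shift equivalence\<close>

locale wieler_shift_equivalence = wieler_quotient +
  fixes K0 :: nat
  assumes r_surj: "rmap ` Q = UNIV"
    and K0: "\<forall>x\<in>XuP. \<forall>y\<in>XuP. (\<forall>i\<le>K0. x i = y i) \<longrightarrow> (x, y) \<in> R0"
begin

abbreviation s where "s \<equiv> smap g \<beta> K \<gamma> P \<epsilon>Y K0"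
abbreviation Xt where "Xt \<equiv> Xtilde g \<beta> K \<gamma> P \<epsilon>Y"
abbreviation TX where "TX \<equiv> sol_topology g K \<gamma>"
abbreviation TXt where "TXt \<equiv> Xtilde_topology g \<beta> K \<gamma> P \<epsilon>Y"

lemma ex_Xu_zeroth: obtains x where "x \<in> XuP" "x 0 = y"
  using r_surj by (metis Q_cases UNIV_I imageE rmap_cls)

text \<open>The representative built in \<open>smap\<close> from a choice \<open>z\<close> is
  \<open>(\<phi> ^^ K0) z\<close>. Two choices agree in the coordinates 0 to \<open>K0\<close>, so
  the assumption \<open>K0\<close> identifies their classes.\<close>

lemma smap_eq:
  assumes "x \<in> XuP"
  shows "s (x 0) = cls ((\<phi> ^^ K0) x)"
proof -
  have eq: "(\<lambda>n. if n \<le> K0 then (g ^^ (K0 - n)) (x 0) else z (n - K0)) = (\<phi> ^^ K0) z"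
    if "z 0 = x 0" for z
    using that by (auto simp: funpow_limit_shift)
  have cls_lift: "cls ((\<phi> ^^ K0) z) = cls ((\<phi> ^^ K0) x)" if "z \<in> XuP" "z 0 = x 0" for z
    using K0 funpow_\<phi>_Xu that assms by (intro cls_eqI) (auto simp: funpow_limit_shift)
  have "s (x 0) = cls (\<lambda>n. if n \<le> K0 then (g ^^ (K0 - n)) (x 0) else x (n - K0))"
    unfolding smap_def
  proof (rule the_elem_image_unique)
    show "{z \<in> XuP. z 0 = x 0} \<noteq> {}" using assms by blast
    fix z assume "z \<in> {z \<in> XuP. z 0 = x 0}"
    then have z: "z \<in> XuP" "z 0 = x 0" by simp_all
    show "cls (\<lambda>n. if n \<le> K0 then (g ^^ (K0 - n)) (x 0) else z (n - K0)) =
        cls (\<lambda>n. if n \<le> K0 then (g ^^ (K0 - n)) (x 0) else x (n - K0))"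
      unfolding eq[of z, OF z(2)] eq[of x, OF refl] by (rule cls_lift[OF z])
  qed
  then show ?thesis unfolding eq[of x, OF refl] .
qed

lemma smap_in_Q: "s y \<in> Q"
proof -
  obtain x where "x \<in> XuP" "x 0 = y" by (rule ex_Xu_zeroth)
  then show ?thesis using smap_eq cls_in_Q funpow_\<phi>_Xu by metis
qed

text \<open>If \<open>x\<close> lies over \<open>y\<close>, then \<open>\<phi> x\<close> lies over
  \<open>g y\<close> and can serve as the choice there.\<close>

lemma smap_g: "s (g y) = gt (s y)"
proof -
  obtain x where x: "x \<in> XuP" "x 0 = y" by (rule ex_Xu_zeroth)
  show ?thesis
    using smap_eq[OF \<phi>_Xu[OF x(1)]] smap_eq[OF x(1)] x
    by (simp add: gtilde_cls funpow_\<phi>_Xu funpow_swap1)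
qed

lemma rmap_smap: "rmap (s y) = (g ^^ K0) y"
proof -
  obtain x where x: "x \<in> XuP" "x 0 = y" by (rule ex_Xu_zeroth)
  show ?thesis
    using smap_eq[OF x(1)] x by (simp add: rmap_cls funpow_\<phi>_Xu funpow_limit_shift)
qed

lemma smap_rmap: "c \<in> Q \<Longrightarrow> s (rmap c) = (gt ^^ K0) c"
  by (metis Q_cases funpow_gtilde_cls rmap_cls smap_eq)

text \<open>Only \<open>s \<circ> g ^^ K\<close>, rather than \<open>s\<close> itself, is directly seen to be continuous, because
  points near \<open>x 0\<close> lift to the leaf of \<open>x\<close> only after applying \<open>g ^^ K\<close>.\<close>

lemma smap_funpow_local:
  assumes "openin TQ V" "s ((g ^^ K) y) \<in> V"
  obtains \<rho> where "0 < \<rho>" "\<And>y'. dist y y' < \<rho> \<Longrightarrow> s ((g ^^ K) y') \<in> V"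
proof -
  obtain x where x: "x \<in> XuP" "x 0 = y" by (rule ex_Xu_zeroth)
  \<comment> \<open>This expresses \<open>s\<close> after \<open>g ^^ K\<close> through iterates of
    \<open>\<phi>\<close> on leaves; a lift \<open>z\<close> enters only through
    \<open>(g ^^ K) (z 0)\<close>, which is what \<open>local_lift\<close> controls.\<close>
  have s_eq: "s ((g ^^ K) (z 0)) = cls ((\<phi> ^^ (K0 + K)) z)" if "z \<in> XuP" for z
    using smap_eq[OF funpow_\<phi>_Xu[OF that, of K]] by (simp add: funpow_limit_shift funpow_add)
  have "openin TXu {x \<in> XuP. cls x \<in> V}"
    using assms(1) by (simp add: openin_quotient_topology topspace_Xu)
  moreover have "(\<phi> ^^ (K0 + K)) x \<in> {x \<in> XuP. cls x \<in> V}"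
    using assms(2) s_eq[OF x(1)] x(2) funpow_\<phi>_Xu[OF x(1)] by simp
  ultimately obtain \<epsilon> where \<epsilon>: "0 < \<epsilon>" "N ((\<phi> ^^ (K0 + K)) x) \<epsilon> \<subseteq> {x \<in> XuP. cls x \<in> V}"
    unfolding openin_Xu_iff by blast
  obtain \<eta> where \<eta>: "0 < \<eta>"
    "\<And>x y. x \<in> X \<Longrightarrow> y \<in> N x \<eta> \<Longrightarrow> (\<phi> ^^ (K0 + K)) y \<in> N ((\<phi> ^^ (K0 + K)) x) \<epsilon>"
    using N_funpow_\<phi>[OF \<epsilon>(1)] by metis
  obtain \<rho> where \<rho>: "0 < \<rho>"
    "\<And>x y. x \<in> X \<Longrightarrow> dist (x 0) y < \<rho> \<Longrightarrow> \<exists>z\<in>N x (min \<eta> \<beta>). (g ^^ K) (z 0) = (g ^^ K) y"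
    using local_lift[of "min \<eta> \<beta>"] \<eta>(1) \<beta>_pos by (metis min_less_iff_conj)
  have "s ((g ^^ K) y') \<in> V" if "dist y y' < \<rho>" for y'
  proof -
    obtain z where z: "z \<in> N x (min \<eta> \<beta>)" "(g ^^ K) (z 0) = (g ^^ K) y'"
      using \<rho>(2)[OF XuP_subset[OF x(1)]] \<open>dist y y' < \<rho>\<close> x(2) by blast
    have "z \<in> XuP" using N_subset_Xu[OF x(1), of "min \<eta> \<beta>"] z(1) by auto
    moreover have "z \<in> N x \<eta>" using N_mono[of "min \<eta> \<beta>" \<eta> x] z(1) by auto
    then have "cls ((\<phi> ^^ (K0 + K)) z) \<in> V" using \<eta>(2)[OF XuP_subset[OF x(1)]] \<epsilon>(2) by blast
    ultimately show ?thesis using s_eq z(2) by metis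
  qed
  then show thesis using that \<rho>(1) by blast
qed

section \<open>The conjugacy between the two solenoids\<close>

lemma gt_Xt: "c \<in> Xt \<Longrightarrow> (gt ^^ k) (c (n + k)) = c n"
  unfolding Xtilde_def by (rule inverse_limit_funpow)

lemma Xt_in_Q: "c \<in> Xt \<Longrightarrow> c n \<in> Q"
  by (simp add: Xtilde_def inverse_limit_def)

lemma smap_seq_in_Xt: "y \<in> X \<Longrightarrow> (\<lambda>n. s (y n)) \<in> Xt"
  unfolding Xtilde_def inverse_limit_def by (auto simp: smap_in_Q simp flip: smap_g)

lemma rmap_seq_in_X: "c \<in> Xt \<Longrightarrow> (\<lambda>n. rmap (c (n + K0))) \<in> X"
  unfolding Xtilde_def inverse_limit_def by (auto simp flip: rmap_gtilde)

lemma topspace_TX: "topspace TX = X"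
  by (simp add: sol_topology_def)

lemma topspace_TXt: "topspace TXt = Xt"
  using Xt_in_Q by (auto simp: Xtilde_topology_def topspace_Q)

text \<open>Each component is rewritten with the coordinate \<open>K\<close> steps further back in
  the history, so that the continuity of \<open>s\<close> after \<open>g ^^ K\<close>
  applies.\<close>

lemma continuous_map_smap_seq: "continuous_map TX TXt (\<lambda>y n. s (y n))"
  unfolding Xtilde_topology_def
proof (rule continuous_map_into_subtopology)
  show "(\<lambda>y n. s (y n)) \<in> topspace TX \<rightarrow> Xt"
    using smap_seq_in_Xt by (auto simp: topspace_TX)
  show "continuous_map TX (product_topology (\<lambda>n. TQ) UNIV) (\<lambda>y n. s (y n))"
  proof (subst continuous_map_componentwise_UNIV, rule allI)
    fix n
    show "continuous_map TX TQ (\<lambda>y. s (y n))"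
      unfolding continuous_map_def topspace_TX topspace_Q
    proof (intro conjI allI impI)
      show "(\<lambda>y. s (y n)) \<in> X \<rightarrow> Q" using smap_in_Q by blast
      fix V assume V: "openin TQ V"
      show "openin TX {y \<in> X. s (y n) \<in> V}"
        unfolding sol_topology_def Xm.openin_mtopology
      proof (intro conjI allI impI)
        fix y assume "y \<in> {y \<in> X. s (y n) \<in> V}"
        then have y: "y \<in> X" "s (y n) \<in> V" by auto
        have coord: "y' n = (g ^^ K) (y' (n + K))" if "y' \<in> X" for y'
          using inverse_limit_funpow[OF that] by simp
        have "s ((g ^^ K) (y (n + K))) \<in> V" using y(2) coord[OF y(1)] by simp
        then obtain \<rho> where \<rho>: "0 < \<rho>"
          "\<And>y'. dist (y (n + K)) y' < \<rho> \<Longrightarrow> s ((g ^^ K) y') \<in> V"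
          using smap_funpow_local[OF V] by blast
        \<comment> \<open>The factor \<open>\<gamma> ^ (n + K)\<close> offsets the weight of
          coordinate \<open>n + K\<close> in \<open>dist_le_dX\<close>.\<close>
        have "Xm.mball y (\<gamma> ^ (n + K) * \<rho>) \<subseteq> {y \<in> X. s (y n) \<in> V}"
        proof
          fix y' assume "y' \<in> Xm.mball y (\<gamma> ^ (n + K) * \<rho>)"
          then have y': "y' \<in> X" "dX y y' < \<gamma> ^ (n + K) * \<rho>" by auto
          then have "\<gamma> ^ (n + K) * dist (y (n + K)) (y' (n + K)) < \<gamma> ^ (n + K) * \<rho>"
            using dist_le_dX[of "n + K" y y'] by linarith
          then have "dist (y (n + K)) (y' (n + K)) < \<rho>" using \<gamma>_pos by simp
          then show "y' \<in> {y \<in> X. s (y n) \<in> V}"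
            using \<rho>(2) coord[OF y'(1)] y'(1) by simp
        qed
        then show "\<exists>r>0. Xm.mball y r \<subseteq> {y \<in> X. s (y n) \<in> V}"
          using \<rho>(1) \<gamma>_pos by (intro exI[of _ "\<gamma> ^ (n + K) * \<rho>"]) auto
      qed auto
    qed
  qed
qed

text \<open>By \<open>dX_small\<close>, closeness in a single coordinate \<open>m\<close> forces
  membership in a given ball, so continuity of \<open>rmap\<close> at index \<open>m + K0\<close>
  suffices.\<close>

lemma continuous_map_rmap_seq: "continuous_map TXt TX (\<lambda>c n. rmap (c (n + K0)))"
  unfolding continuous_map_def topspace_TX topspace_TXt
proof (intro conjI allI impI)
  show "(\<lambda>c n. rmap (c (n + K0))) \<in> Xt \<rightarrow> X" using rmap_seq_in_X by blast
  fix U assume U: "openin TX U"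
  show "openin TXt {c \<in> Xt. (\<lambda>n. rmap (c (n + K0))) \<in> U}"
  proof (subst openin_subopen, rule ballI)
    fix c assume "c \<in> {c \<in> Xt. (\<lambda>n. rmap (c (n + K0))) \<in> U}"
    then have c: "c \<in> Xt" "(\<lambda>n. rmap (c (n + K0))) \<in> U" by auto
    then obtain r where r: "0 < r" "Xm.mball (\<lambda>n. rmap (c (n + K0))) r \<subseteq> U"
      using U unfolding sol_topology_def Xm.openin_mtopology by blast
    obtain m \<rho> where \<rho>: "0 < \<rho>"
      "\<And>x y. x \<in> X \<Longrightarrow> y \<in> X \<Longrightarrow> dist (x m) (y m) < \<rho> \<Longrightarrow> dX x y < r"
      using dX_small[OF r(1)] by metis
    have "continuous_map TXt TQ (\<lambda>c. c (m + K0))"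
      unfolding Xtilde_topology_def
      by (intro continuous_map_from_subtopology continuous_map_product_projection) auto
    then have "continuous_map TXt euclidean (rmap \<circ> (\<lambda>c. c (m + K0)))"
      by (rule continuous_map_compose[OF _ continuous_map_rmap])
    then have "openin TXt {c' \<in> topspace TXt.
        (rmap \<circ> (\<lambda>c. c (m + K0))) c' \<in> ball (rmap (c (m + K0))) \<rho>}"
      by (rule openin_continuous_map_preimage) simp
    then have "openin TXt {c' \<in> Xt. dist (rmap (c (m + K0))) (rmap (c' (m + K0))) < \<rho>}"
      by (simp add: topspace_TXt)
    moreover have "{c' \<in> Xt. dist (rmap (c (m + K0))) (rmap (c' (m + K0))) < \<rho>}
        \<subseteq> {c \<in> Xt. (\<lambda>n. rmap (c (n + K0))) \<in> U}"
      using rmap_seq_in_X c(1) r(2) by (auto intro!: \<rho>(2) subsetD[OF r(2)])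
    ultimately show "\<exists>T. openin TXt T \<and> c \<in> T \<and> T \<subseteq> {c \<in> Xt. (\<lambda>n. rmap (c (n + K0))) \<in> U}"
      using c(1) \<rho>(1) by (intro exI conjI) auto
  qed
qed

lemma conjugacy_smap_seq: "conjugacy TX \<phi> TXt (limit_shift gt) (\<lambda>y n. s (y n))"
  unfolding conjugacy_def
proof (intro conjI ballI)
  \<comment> \<open>Either composite applies \<open>g ^^ K0\<close> or \<open>gt ^^ K0\<close> to
    the entry at \<open>n + K0\<close>, which returns the entry at \<open>n\<close>.\<close>
  have "homeomorphic_maps TX TXt (\<lambda>y n. s (y n)) (\<lambda>c n. rmap (c (n + K0)))"
    unfolding homeomorphic_maps_def topspace_TX topspace_TXt
    using continuous_map_smap_seq continuous_map_rmap_seq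
    by (auto simp: rmap_smap smap_rmap Xt_in_Q gt_Xt inverse_limit_funpow)
  then show "homeomorphic_map TX TXt (\<lambda>y n. s (y n))"
    by (auto simp: homeomorphic_map_maps)
  fix y
  show "(\<lambda>n. s (\<phi> y n)) = limit_shift gt (\<lambda>n. s (y n))"
    by (rule ext) (simp add: limit_shift_def smap_g split: nat.splits)
qed

end

theorem theorem3p11:
  fixes g :: "'a::metric_space \<Rightarrow> 'a"
    and \<beta> \<gamma> \<epsilon>Y :: real
    and K K0 :: nat
    and P :: "(nat \<Rightarrow> 'a) set"
  assumes wieler: "wieler_axioms g \<beta> K \<gamma>"
    and P_sub: "P \<subseteq> solenoid g"
    and P_fin: "finite P"
    and P_inv: "limit_shift g ` P \<subseteq> P"
    and P_per: "\<forall>p\<in>P. \<exists>n>0. (limit_shift g ^^ n) p = p"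
    and epsY: "0 < \<epsilon>Y" "\<epsilon>Y \<le> \<beta> / 2"
    and pi0_inj: "\<forall>z\<in>Xu g K \<gamma> P. inj_on (\<lambda>x. x 0) (Xu_nbhd g K \<gamma> z \<epsilon>Y)"
    and r_surj: "rmap ` Xu_quot g \<beta> K \<gamma> P \<epsilon>Y = UNIV"
    and K0_pos: "0 < K0"
    and K0: "\<forall>x\<in>Xu g K \<gamma> P. \<forall>y\<in>Xu g K \<gamma> P.
               (\<forall>i\<le>K0. x i = y i) \<longrightarrow> (x, y) \<in> rel0 g \<beta> K \<gamma> P \<epsilon>Y"
  shows "gtilde g \<beta> K \<gamma> P \<epsilon>Y \<in> Xu_quot g \<beta> K \<gamma> P \<epsilon>Y \<rightarrow> Xu_quot g \<beta> K \<gamma> P \<epsilon>Y \<and>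
    smap g \<beta> K \<gamma> P \<epsilon>Y K0 \<in> UNIV \<rightarrow> Xu_quot g \<beta> K \<gamma> P \<epsilon>Y \<and>
    (\<forall>c\<in>Xu_quot g \<beta> K \<gamma> P \<epsilon>Y. rmap (gtilde g \<beta> K \<gamma> P \<epsilon>Y c) = g (rmap c)) \<and>
    (\<forall>y. smap g \<beta> K \<gamma> P \<epsilon>Y K0 (g y) = gtilde g \<beta> K \<gamma> P \<epsilon>Y (smap g \<beta> K \<gamma> P \<epsilon>Y K0 y)) \<and>
    (\<forall>y. rmap (smap g \<beta> K \<gamma> P \<epsilon>Y K0 y) = (g ^^ K0) y) \<and>
    (\<forall>c\<in>Xu_quot g \<beta> K \<gamma> P \<epsilon>Y.
       smap g \<beta> K \<gamma> P \<epsilon>Y K0 (rmap c) = (gtilde g \<beta> K \<gamma> P \<epsilon>Y ^^ K0) c) \<and>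
    conjugacy (sol_topology g K \<gamma>) (limit_shift g)
      (Xtilde_topology g \<beta> K \<gamma> P \<epsilon>Y) (limit_shift (gtilde g \<beta> K \<gamma> P \<epsilon>Y))
      (\<lambda>y n. smap g \<beta> K \<gamma> P \<epsilon>Y K0 (y n))"
proof -
  interpret wieler_shift_equivalence g \<beta> K \<gamma> P \<epsilon>Y K0
    by unfold_locales (fact wieler P_sub P_inv epsY pi0_inj r_surj K0)+
  show ?thesis
    using gtilde_in_Q smap_in_Q rmap_gtilde smap_g rmap_smap smap_rmap conjugacy_smap_seq
    by auto
qed

end
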